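(* Let $G$ be a good finite abelian group of order $n$, and let $p$ be a proper odd prime divisor of $n$ (that is, $p$ is an odd prime dividing $n$ with $p<n$). The following statements hold: (a) every coset of any subgroup of $G$ of order $n/p$ is a perfect code in some Cayley graph of $G$ of degree $p-1$; (b) every perfect code of size $n/p$ in any connected Cayley graph of $G$ of degree $p-1$ is a coset of some subgroup of $G$ of order $n/p$.
   Context: All groups are finite and abelian groups are written additively with identity $0$. For an inverse-closed subset $S\subseteq G\setminus\{0\}$ (i.e. $-S=S$), the Cayley graph $\mathrm{Cay}(G,S)$ has vertex set $G$, with $x,y$ adjacent iff $y-x\in S$; its degree is $|S|$, and it is connected iff $S$ generates $G$. A perfect code in a graph is a set $C$ of vertices such that no two vertices in $C$ are adjacent and every vertex outside $C$ is adjacent to exactly one vertex of $C$. A factorization of $G$ into two factors is a pair $(X,Y)$ of subsets of $G$ such that every element of $G$ can be uniquely written as $x+y$ with $x\in X$, $y\in Y$. A nonempty subset $X\subseteq G$ is periodic if its subgroup of periods $G_X=\{g\in G: X+g=X\}$ is not $\{0\}$. An abelian group $G$ is good if for every factorization $(X,Y)$ of $G$ into two factors at least one of $X,Y$ is periodic. *)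

theory Defs
  imports "HOL-Computational_Algebra.Primes" "HOL-Algebra.Coset" "Graph_Theory.Digraph_Component"
begin

text \<open>
  Abelian groups are \<^locale>\<open>comm_group\<close>s, written multiplicatively as in HOL-Algebra.
\<close>

section \<open>Factorizations, periodicity and good groups\<close>

definition factorization :: "('a, 'b) monoid_scheme \<Rightarrow> 'a set \<Rightarrow> 'a set \<Rightarrow> bool" where
  "factorization G X Y \<longleftrightarrow> X \<subseteq> carrier G \<and> Y \<subseteq> carrier G \<and>
     (\<forall>g\<in>carrier G. \<exists>!(x, y). x \<in> X \<and> y \<in> Y \<and> g = x \<otimes>\<^bsub>G\<^esub> y)"

definition periods :: "('a, 'b) monoid_scheme \<Rightarrow> 'a set \<Rightarrow> 'a set" where
  "periods G X = {g \<in> carrier G. X #>\<^bsub>G\<^esub> g = X}"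

definition periodic :: "('a, 'b) monoid_scheme \<Rightarrow> 'a set \<Rightarrow> bool" where
  "periodic G X \<longleftrightarrow> X \<subseteq> carrier G \<and> X \<noteq> {} \<and> periods G X \<noteq> {\<one>\<^bsub>G\<^esub>}"

definition good :: "('a, 'b) monoid_scheme \<Rightarrow> bool" where
  "good G \<longleftrightarrow> (\<forall>X Y. factorization G X Y \<longrightarrow> periodic G X \<or> periodic G Y)"

section \<open>Cayley graphs\<close>

definition connection_set :: "('a, 'b) monoid_scheme \<Rightarrow> 'a set \<Rightarrow> bool" where
  "connection_set G S \<longleftrightarrow> S \<subseteq> carrier G - {\<one>\<^bsub>G\<^esub>} \<and> set_inv\<^bsub>G\<^esub> S = S"

text \<open>
  Following \<^theory>\<open>Graph_Theory.Digraph\<close>, an undirected graph is a loopfree symmetric digraph: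
  the edge between \<open>x\<close> and \<open>y\<close> is the pair of arcs \<open>(x, y)\<close>, \<open>(y, x)\<close>.
\<close>

definition cayley_graph :: "('a, 'b) monoid_scheme \<Rightarrow> 'a set \<Rightarrow> ('a, 'a \<times> 'a) pre_digraph" where
  "cayley_graph G S =
     \<lparr>verts = carrier G,
      arcs = {(x, y). x \<in> carrier G \<and> y \<in> carrier G \<and> y \<otimes>\<^bsub>G\<^esub> inv\<^bsub>G\<^esub> x \<in> S},
      tail = fst, head = snd\<rparr>"

definition regular_of_degree :: "('a, 'b) pre_digraph \<Rightarrow> nat \<Rightarrow> bool" where
  "regular_of_degree D d \<longleftrightarrow> (\<forall>v\<in>verts D. out_degree D v = d)"

definition perfect_code :: "('a, 'b) pre_digraph \<Rightarrow> 'a set \<Rightarrow> bool" where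
  "perfect_code D C \<longleftrightarrow> C \<subseteq> verts D \<and>
     (\<forall>x\<in>C. \<forall>y\<in>C. \<not> x \<rightarrow>\<^bsub>D\<^esub> y) \<and>
     (\<forall>v\<in>verts D - C. \<exists>!c. c \<in> C \<and> v \<rightarrow>\<^bsub>D\<^esub> c)"

lemma dominates_cayley_graph:
  "x \<rightarrow>\<^bsub>cayley_graph G S\<^esub> y \<longleftrightarrow>
     x \<in> carrier G \<and> y \<in> carrier G \<and> y \<otimes>\<^bsub>G\<^esub> inv\<^bsub>G\<^esub> x \<in> S"
  by (auto simp: cayley_graph_def arcs_ends_def arc_to_ends_def)

lemma graph_cayley_graph:
  assumes "group G" "finite (carrier G)" "connection_set G S"
  shows "graph (cayley_graph G S)"
proof -
  interpret group G by fact
  let ?D = "cayley_graph G S"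
  have S: "S \<subseteq> carrier G" "\<one>\<^bsub>G\<^esub> \<notin> S" "\<And>s. s \<in> S \<Longrightarrow> inv\<^bsub>G\<^esub> s \<in> S"
    using assms(3) by (auto simp: connection_set_def SET_INV_def)
  have "sym (arcs_ends ?D)"
  proof (rule symI)
    fix x y assume "(x, y) \<in> arcs_ends ?D"
    then have xy: "x \<in> carrier G" "y \<in> carrier G" "y \<otimes>\<^bsub>G\<^esub> inv\<^bsub>G\<^esub> x \<in> S"
      by (auto simp: dominates_cayley_graph)
    then have "inv\<^bsub>G\<^esub> (y \<otimes>\<^bsub>G\<^esub> inv\<^bsub>G\<^esub> x) = x \<otimes>\<^bsub>G\<^esub> inv\<^bsub>G\<^esub> y"
      by (simp add: inv_mult_group)
    with xy S show "(y, x) \<in> arcs_ends ?D"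
      by (metis dominates_cayley_graph)
  qed
  moreover have "finite (arcs ?D)"
    by (rule finite_subset[of _ "carrier G \<times> carrier G"])
      (use assms(2) in \<open>auto simp: cayley_graph_def\<close>)
  ultimately show ?thesis
    using S assms(2)
    by unfold_locales
      (auto simp: cayley_graph_def arc_to_ends_def symmetric_def)
qed

lemma regular_cayley_graph_iff:
  assumes "group G" "connection_set G S"
  shows "regular_of_degree (cayley_graph G S) d \<longleftrightarrow> card S = d"
proof -
  interpret group G by fact
  have S: "S \<subseteq> carrier G"
    using assms(2) by (auto simp: connection_set_def)
  have "out_degree (cayley_graph G S) v = card S" if v: "v \<in> carrier G" for v
  proof -
    have "bij_betw (\<lambda>s. (v, s \<otimes>\<^bsub>G\<^esub> v)) S (out_arcs (cayley_graph G S) v)"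
      by (rule bij_betw_byWitness[where f' = "\<lambda>e. snd e \<otimes>\<^bsub>G\<^esub> inv\<^bsub>G\<^esub> v"])
        (use v S in \<open>auto simp: out_arcs_def cayley_graph_def m_assoc subset_iff\<close>)
    then show ?thesis
      by (simp add: out_degree_def bij_betw_same_card)
  qed
  then show ?thesis
    by (auto simp: regular_of_degree_def cayley_graph_def)
qed

end

theory Submission
  imports Defs "HOL-Algebra.Sylow" "HOL-Algebra.Multiplicative_Group"
begin

text \<open>
  A set \<open>C\<close> is a perfect code in the Cayley graph of \<open>S\<close> exactly when \<open>insert \<one> S\<close> and \<open>C\<close> form a
  factorization of \<open>G\<close> (\<open>perfect_code_cayley_graph_iff\<close>), so both parts are statements about
  factorizations whose first factor has \<open>p\<close> elements.

  For part (a), a subgroup \<open>H\<close> of index \<open>p\<close> has an inverse-closed transversal through \<open>\<one>\<close>, made of the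
  powers of any element outside \<open>H\<close> with small positive and negative exponents
  (\<open>ex_connection_set_complementing_coset\<close>).

  For part (b), connectedness says that \<open>A = insert \<one> S\<close> generates \<open>G\<close>. If \<open>A\<close> is periodic, it is a subgroup
  because its cardinality is prime, hence it is all of \<open>G\<close> and \<open>C\<close> is a single point. Otherwise goodness makes \<open>C\<close> periodic, and one
  wants to divide by a subgroup of periods of prime order and argue by induction. This needs the
  quotient to be good again. Subgroups of a good group are good as soon as they contain an element
  that is not its own inverse (\<open>good_subgroup\<close>): an aperiodic factorization of the
  subgroup extends to one of the group along an aperiodic transversal. Quotients are reduced to
  subgroups: every subgroup of prime order is the kernel of an endomorphism
  (\<open>ex_endomorphism_with_kernel\<close>), because its generator lies in a cyclic direct factor in which
  the subgroup is the kernel of a power map (\<open>ex_cyclic_direct_factor\<close>). The induction is carried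
  out in \<open>prime_card_generating_factor_complement_is_coset\<close>.
\<close>

section \<open>Powers and subgroups\<close>

lemma (in group) mem_subgroup_of_coprime_pows:
  assumes "subgroup M G" "g \<in> carrier G" "g [^] i \<in> M" "g [^] j \<in> M" "coprime i (j::int)"
  shows "g \<in> M"
proof -
  \<comment> \<open>Bezout coefficients turn the two powers back into \<open>g\<close>.\<close>
  obtain u v where uv: "i * u + j * v = 1"
    using bezout_int[of i j] assms(5) by (auto simp: mult.commute)
  have "g = g [^] (i * u + j * v)"
    using assms(2) by (simp add: uv)
  also have "\<dots> = (g [^] i) [^] u \<otimes> (g [^] j) [^] v"
    using assms(2) by (simp only: int_pow_mult int_pow_pow)
  also have "\<dots> \<in> M"
    using assms by (simp add: subgroup_int_pow_closed subgroup.m_closed)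
  finally show ?thesis .
qed

lemma (in comm_group) subgroup_powers:
  "subgroup ((\<lambda>g. g [^] (n::nat)) ` carrier G) G"
proof (rule subgroupI)
  fix a assume "a \<in> (\<lambda>g. g [^] n) ` carrier G"
  then obtain g where g: "g \<in> carrier G" "a = g [^] n"
    by blast
  then have "inv a = (inv g) [^] n"
    by (simp add: nat_pow_inv)
  then show "inv a \<in> (\<lambda>g. g [^] n) ` carrier G"
    using g(1) by blast
next
  fix a b assume "a \<in> (\<lambda>g. g [^] n) ` carrier G" "b \<in> (\<lambda>g. g [^] n) ` carrier G"
  then obtain g h where g: "g \<in> carrier G" "a = g [^] n" "h \<in> carrier G" "b = h [^] n"
    by blast
  then have "a \<otimes> b = (g \<otimes> h) [^] n"
    by (simp add: nat_pow_distrib)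
  then show "a \<otimes> b \<in> (\<lambda>g. g [^] n) ` carrier G"
    using g by blast
qed auto

lemma (in group) mem_cyclicE:
  assumes fin: "finite (carrier G)" and x: "x \<in> carrier G" and y: "y \<in> generate G {x}"
  obtains i :: nat where "y = x [^] i"
proof -
  obtain k :: int where k: "y = x [^] k"
    using y unfolding generate_pow[OF x] by blast
  have pos: "int (ord x) > 0"
    using ord_ge_1[OF fin x] by simp
  define i where "i = nat (k mod int (ord x))"
  have "int i = k mod int (ord x)"
    using pos by (simp add: i_def)
  then have "int (ord x) dvd k - int i"
    by (simp add: minus_mod_eq_mult_div)
  then have "x [^] int i = x [^] k"
    using int_pow_eq[OF x] by blast
  then show thesis
    using that[of i] by (simp add: k int_pow_int)
qed

lemma (in group) pow_mem_subgroup: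
  assumes "subgroup M G" "g \<in> M"
  shows "g [^] (n::nat) \<in> M"
  using subgroup_int_pow_closed[OF assms, of "int n"] by (simp add: int_pow_int)

lemma (in group) mem_subgroup_of_prime_coprime_pows:
  fixes q i :: nat
  assumes "subgroup M G" "g \<in> carrier G" "g [^] q \<in> M" "g [^] i \<in> M" "prime q" "\<not> q dvd i"
  shows "g \<in> M"
proof (rule mem_subgroup_of_coprime_pows[of M g "int q" "int i"])
  show "coprime (int q) (int i)"
    using assms(5,6) by (simp add: prime_imp_coprime)
qed (use assms in \<open>simp_all add: int_pow_int\<close>)

section \<open>Periods\<close>

lemma (in group) mem_periodsD:
  assumes "g \<in> periods G X" "x \<in> X"
  shows "x \<otimes> g \<in> X"
  using assms by (auto simp: periods_def r_coset_def)

lemma (in group) mem_periodsI: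
  assumes "finite X" "X \<subseteq> carrier G" "g \<in> carrier G" "\<And>x. x \<in> X \<Longrightarrow> x \<otimes> g \<in> X"
  shows "g \<in> periods G X"
proof -
  have "inj_on (\<lambda>x. x \<otimes> g) X"
  proof (rule inj_onI)
    fix x y assume "x \<in> X" "y \<in> X" "x \<otimes> g = y \<otimes> g"
    with assms(2,3) show "x = y"
      by (simp add: subset_iff)
  qed
  then have "card ((\<lambda>x. x \<otimes> g) ` X) = card X"
    by (rule card_image)
  moreover have "(\<lambda>x. x \<otimes> g) ` X \<subseteq> X"
    by (rule image_subsetI) (rule assms(4))
  ultimately have "(\<lambda>x. x \<otimes> g) ` X = X"
    using assms(1) by (metis card_subset_eq)
  then have "X #> g = X"
    unfolding r_coset_def by blast
  then show ?thesis
    using assms(3) by (simp add: periods_def)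
qed

lemma (in group) subgroup_periods:
  assumes "X \<subseteq> carrier G"
  shows "subgroup (periods G X) G"
proof (rule subgroupI)
  show "periods G X \<noteq> {}"
    using coset_mult_one[OF assms] unfolding periods_def by blast
next
  fix g assume g: "g \<in> periods G X"
  then have c: "g \<in> carrier G" and "X #> g = X"
    by (simp_all add: periods_def)
  then have "X #> inv g = (X #> g) #> inv g"
    by simp
  also have "\<dots> = X"
    using coset_mult_assoc[OF assms c inv_closed[OF c]] c assms by simp
  finally show "inv g \<in> periods G X"
    using c by (simp add: periods_def)
next
  fix g h assume "g \<in> periods G X" "h \<in> periods G X"
  then have gh: "g \<in> carrier G" "h \<in> carrier G" "X #> g = X" "X #> h = X"
    by (simp_all add: periods_def)
  then have "X #> (g \<otimes> h) = X"
    using coset_mult_assoc[OF assms gh(1,2)] by metis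
  then show "g \<otimes> h \<in> periods G X"
    using gh(1,2) by (simp add: periods_def)
qed (auto simp: periods_def)

lemma (in group) periodicE:
  assumes "periodic G X"
  obtains g where "g \<in> periods G X" "g \<in> carrier G" "g \<noteq> \<one>"
proof -
  have X: "X \<subseteq> carrier G" "periods G X \<noteq> {\<one>}"
    using assms by (simp_all add: periodic_def)
  have "\<one> \<in> periods G X"
    by (rule subgroup.one_closed[OF subgroup_periods[OF X(1)]])
  with X(2) obtain g where "g \<in> periods G X" "g \<noteq> \<one>"
    by blast
  moreover from this have "g \<in> carrier G"
    by (simp add: periods_def)
  ultimately show thesis
    using that by blast
qed

lemma (in group) aperiodicD:
  assumes "\<not> periodic G X" "X \<subseteq> carrier G" "X \<noteq> {}" "g \<in> periods G X"
  shows "g = \<one>"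
  using assms by (auto simp: periodic_def)

section \<open>Factorizations\<close>

lemma (in group) factorizationI:
  assumes "X \<subseteq> carrier G" "Y \<subseteq> carrier G"
    and ex: "\<And>g. g \<in> carrier G \<Longrightarrow> \<exists>x\<in>X. \<exists>y\<in>Y. g = x \<otimes> y"
    and unique: "\<And>x y x' y'. x \<in> X \<Longrightarrow> y \<in> Y \<Longrightarrow> x' \<in> X \<Longrightarrow> y' \<in> Y \<Longrightarrow>
      x \<otimes> y = x' \<otimes> y' \<Longrightarrow> x = x' \<and> y = y'"
  shows "factorization G X Y"
  unfolding factorization_def
proof (intro conjI ballI)
  fix g assume "g \<in> carrier G"
  then obtain x y where xy: "x \<in> X" "y \<in> Y" "g = x \<otimes> y"
    using ex by blast
  show "\<exists>!(x, y). x \<in> X \<and> y \<in> Y \<and> g = x \<otimes> y"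
  proof (rule ex1I[of _ "(x, y)"])
    show "case (x, y) of (x, y) \<Rightarrow> x \<in> X \<and> y \<in> Y \<and> g = x \<otimes> y"
      using xy by simp
  next
    fix z assume z: "case z of (x, y) \<Rightarrow> x \<in> X \<and> y \<in> Y \<and> g = x \<otimes> y"
    obtain x' y' where [simp]: "z = (x', y')"
      by (cases z)
    show "z = (x, y)"
      using unique[of x' y' x y] z xy by simp
  qed
qed fact+

lemma (in group)
  assumes "factorization G X Y"
  shows factorization_subset: "X \<subseteq> carrier G" "Y \<subseteq> carrier G"
    and factorization_ex: "g \<in> carrier G \<Longrightarrow> \<exists>x\<in>X. \<exists>y\<in>Y. g = x \<otimes> y"
    and factorization_nonempty: "X \<noteq> {}" "Y \<noteq> {}"
proof -
  show "X \<subseteq> carrier G" "Y \<subseteq> carrier G"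
    using assms by (simp_all add: factorization_def)
  show ex: "\<exists>x\<in>X. \<exists>y\<in>Y. g = x \<otimes> y" if "g \<in> carrier G" for g
  proof -
    have "\<exists>!(x, y). x \<in> X \<and> y \<in> Y \<and> g = x \<otimes> y"
      using assms that unfolding factorization_def by blast
    then obtain z where "case z of (x, y) \<Rightarrow> x \<in> X \<and> y \<in> Y \<and> g = x \<otimes> y"
      by (rule ex1E)
    then show ?thesis
      by (cases z) auto
  qed
  show "X \<noteq> {}" "Y \<noteq> {}"
    using ex[OF one_closed] by auto
qed

lemma (in group) factorization_unique:
  assumes XY: "factorization G X Y" and xy: "x \<in> X" "y \<in> Y" "x' \<in> X" "y' \<in> Y"
    and eq: "x \<otimes> y = x' \<otimes> y'"
  shows "x = x' \<and> y = y'"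
proof -
  have "x \<otimes> y \<in> carrier G"
    using factorization_subset[OF XY] xy by (simp add: subset_iff)
  then have "\<exists>!(u, v). u \<in> X \<and> v \<in> Y \<and> x \<otimes> y = u \<otimes> v"
    using XY unfolding factorization_def by blast
  then have "(x, y) = (x', y')"
    by (rule ex1E) (use xy eq in \<open>metis (mono_tags, lifting) case_prodI\<close>)
  then show ?thesis
    by simp
qed

lemma (in group) factorization_card:
  assumes "factorization G X Y"
  shows "card X * card Y = order G"
proof -
  have "inj_on (\<lambda>(x, y). x \<otimes> y) (X \<times> Y)"
    using factorization_unique[OF assms] by (intro inj_onI) auto
  then have "card ((\<lambda>(x, y). x \<otimes> y) ` (X \<times> Y)) = card X * card Y"
    by (simp add: card_image card_cartesian_product)
  moreover have "(\<lambda>(x, y). x \<otimes> y) ` (X \<times> Y) = carrier G"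
  proof
    show "(\<lambda>(x, y). x \<otimes> y) ` (X \<times> Y) \<subseteq> carrier G"
      using factorization_subset[OF assms] by (auto simp: subset_iff)
    show "carrier G \<subseteq> (\<lambda>(x, y). x \<otimes> y) ` (X \<times> Y)"
      using factorization_ex[OF assms] by force
  qed
  ultimately show ?thesis
    by (simp add: order_def)
qed

section \<open>Aperiodic transversals and subgroups of good groups\<close>

lemma (in comm_group) mult_mult_inv_cancel:
  assumes "a \<in> carrier G" "b \<in> carrier G"
  shows "a \<otimes> b \<otimes> inv a = b"
proof -
  have "a \<otimes> b \<otimes> inv a = b \<otimes> (a \<otimes> inv a)"
    using assms by (simp only: m_comm[of a b] m_assoc inv_closed)
  then show ?thesis
    using assms by simp
qed

text \<open>
  Suppose \<open>g\<close> and \<open>g'\<close> are nontrivial periods of the two sets \<open>D \<union> {t}\<close> and \<open>D \<union> {t h}\<close>. Every element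
  of either set apart from the exceptional one lies in \<open>D\<close>, hence in the other set. Following \<open>t\<close>
  under \<open>g\<close>, then \<open>g'\<close>, and undoing both in the same order brings \<open>t\<close> back into the second set unless
  \<open>t g g'\<close> is the exceptional point \<open>t h\<close>; so \<open>g g' = h\<close>. Starting from \<open>t h\<close> instead gives
  \<open>g' g = inv h\<close>, and therefore \<open>h\<close> is its own inverse.
\<close>

lemma (in comm_group) insert_aperiodic:
  assumes D: "D \<subseteq> carrier G" and t: "t \<in> carrier G" and h: "h \<in> carrier G"
    and "t \<notin> D" "t \<otimes> h \<notin> D" and hh: "h \<otimes> h \<noteq> \<one>"
  shows "\<not> periodic G (insert t D) \<or> \<not> periodic G (insert (t \<otimes> h) D)"
proof (rule ccontr)
  \<comment> \<open>The situation is symmetric under exchanging the two sets and \<open>h\<close> with its inverse.\<close>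
  have key: "g \<otimes> g' = k"
    if per: "g \<in> periods G (insert u D)" "g' \<in> periods G (insert (u \<otimes> k) D)"
      and ne: "g \<noteq> \<one>" "g' \<noteq> \<one>" and u: "u \<in> carrier G" "u \<notin> D"
      and k: "k \<in> carrier G" "u \<otimes> k \<notin> D" "k \<noteq> \<one>" for g g' u k
  proof (rule ccontr)
    assume neq: "g \<otimes> g' \<noteq> k"
    have c: "g \<in> carrier G" "g' \<in> carrier G"
      using per by (auto simp: periods_def)
    have "u \<otimes> g \<in> insert u D"
      by (rule mem_periodsD[OF per(1)]) simp
    moreover have "u \<otimes> g \<noteq> u"
      using u(1) c(1) ne(1) by simp
    ultimately have "u \<otimes> g \<in> insert (u \<otimes> k) D"
      by simp
    then have "u \<otimes> g \<otimes> g' \<in> insert (u \<otimes> k) D"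
      by (rule mem_periodsD[OF per(2)])
    moreover have "u \<otimes> g \<otimes> g' \<noteq> u \<otimes> k"
      using neq c k u by (simp add: m_assoc)
    ultimately have "u \<otimes> g \<otimes> g' \<in> insert u D"
      by auto
    then have "u \<otimes> g \<otimes> g' \<otimes> inv g \<in> insert u D"
      by (rule mem_periodsD[OF subgroup.m_inv_closed[OF subgroup_periods per(1)], rotated])
        (use D u(1) in simp)
    moreover have "u \<otimes> g \<otimes> g' \<otimes> inv g = u \<otimes> g'"
      using u(1) c mult_mult_inv_cancel[OF c(1), of g'] by (simp add: m_assoc)
    moreover have "u \<otimes> g' \<noteq> u"
      using u(1) c(2) ne(2) by simp
    ultimately have "u \<otimes> g' \<in> insert (u \<otimes> k) D"
      by simp
    then have "u \<otimes> g' \<otimes> inv g' \<in> insert (u \<otimes> k) D"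
      by (rule mem_periodsD[OF subgroup.m_inv_closed[OF subgroup_periods per(2)], rotated])
        (use D u(1) k(1) in simp)
    moreover have "u \<otimes> g' \<otimes> inv g' = u"
      using u(1) c(2) by (simp add: m_assoc)
    moreover have "u \<noteq> u \<otimes> k"
      using u(1) k(1,3) by simp
    ultimately show False
      using u(2) by simp
  qed
  assume "\<not> ?thesis"
  then obtain g g' where g: "g \<in> periods G (insert t D)" "g \<noteq> \<one>" "g \<in> carrier G"
    and g': "g' \<in> periods G (insert (t \<otimes> h) D)" "g' \<noteq> \<one>" "g' \<in> carrier G"
    by (metis periodicE)
  have h1: "h \<noteq> \<one>" using hh by auto
  have "g \<otimes> g' = h"
    by (rule key[of g t g' h]) (use assms g g' h1 in auto)
  moreover have "g' \<otimes> g = inv h"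
    by (rule key[of g' "t \<otimes> h" g "inv h"]) (use assms g g' h1 in \<open>auto simp: m_assoc\<close>)
  ultimately show False
    using m_comm[OF g(3) g'(3)] r_inv[OF h] hh by simp
qed

lemma (in group) ex_transversal:
  assumes H: "subgroup H G"
  shows "\<exists>T. factorization G H T"
proof -
  define r where "r C = (SOME x. x \<in> C)" for C :: "'a set"
  have r: "r C \<in> C \<and> r C \<in> carrier G \<and> C = H #> r C" if C: "C \<in> rcosets H" for C
  proof -
    obtain x where x: "x \<in> carrier G" "C = H #> x"
      using C unfolding RCOSETS_def by blast
    then have "x \<in> C"
      using rcos_self[OF x(1) H] by simp
    then have rC: "r C \<in> C"
      unfolding r_def by (rule someI)
    then have "C = H #> r C"
      using repr_independence[OF _ x(1) H, of "r C"] x(2) by simp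
    moreover have "r C \<in> carrier G"
      using rC r_coset_subset_G[OF subgroup.subset[OF H] x(1)] x(2) by blast
    ultimately show ?thesis
      using rC by simp
  qed
  have "factorization G H (r ` (rcosets H))"
  proof (rule factorizationI)
    show "H \<subseteq> carrier G"
      using H by (rule subgroup.subset)
    show "r ` (rcosets H) \<subseteq> carrier G"
      using r by (simp add: image_subset_iff)
  next
    fix g assume g: "g \<in> carrier G"
    then have C: "H #> g \<in> rcosets H"
      using H by (simp add: rcosetsI subgroup.subset)
    then have "g \<in> H #> r (H #> g)"
      using r[OF C] rcos_self[OF g H] by simp
    then show "\<exists>x\<in>H. \<exists>y\<in>r ` (rcosets H). g = x \<otimes> y"
      using C unfolding r_coset_def by blast
  next
    fix h t h' t' assume *: "h \<in> H" "t \<in> r ` (rcosets H)" "h' \<in> H" "t' \<in> r ` (rcosets H)"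
      "h \<otimes> t = h' \<otimes> t'"
    then obtain C C' where C: "C \<in> rcosets H" "t = r C" "C' \<in> rcosets H" "t' = r C'"
      by blast
    have "h \<otimes> t \<in> C" "h' \<otimes> t' \<in> C'"
      using rcosI[OF *(1) subgroup.subset[OF H], of t] rcosI[OF *(3) subgroup.subset[OF H], of t']
        r[OF C(1)] r[OF C(3)] C(2,4) by simp_all
    then have "C = C'"
      using *(5) C(1,3) rcos_disjoint[OF H] unfolding pairwise_def disjnt_def by (metis disjoint_iff)
    moreover have "h \<in> carrier G" "h' \<in> carrier G" "t \<in> carrier G"
      using * H r[OF C(1)] C(2) by (simp_all add: subgroup.mem_carrier)
    ultimately show "h = h' \<and> t = t'"
      using C(2,4) *(5) by simp
  qed
  then show ?thesis ..
qed

text \<open>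
  A transversal of \<open>H\<close> is exactly a set \<open>T\<close> with \<open>H T\<close> a factorization. Moving one point of a
  transversal inside its coset of \<open>H\<close> gives another transversal, and if the move is by an element of
  \<open>H\<close> that is not its own inverse, the two cannot both be periodic. Some restriction on \<open>H\<close> is
  unavoidable: in the Klein four-group every transversal of a subgroup of order two is periodic.
\<close>

lemma (in comm_group) ex_aperiodic_transversal:
  assumes H: "subgroup H G" and h: "h \<in> H" "h \<otimes> h \<noteq> \<one>"
  shows "\<exists>T. factorization G H T \<and> \<not> periodic G T"
proof -
  obtain T where T: "factorization G H T"
    using ex_transversal[OF H] ..
  note TD = factorization_subset[OF T] factorization_ex[OF T] factorization_unique[OF T]
  obtain t where t: "t \<in> T"
    using factorization_nonempty[OF T] by auto
  define D where "D = T - {t}"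
  have c: "h \<in> carrier G" "t \<in> carrier G" "D \<subseteq> carrier G"
    using h t TD(1,2) by (auto simp: D_def)
  have other: "d = t" if "d \<in> T" "d = k \<otimes> t" "k \<in> H" for d k
    using TD(4)[of \<one> d k t] that t TD(2) subgroup.one_closed[OF H] by auto
  have nD: "t \<notin> D" "t \<otimes> h \<notin> D"
    using other[of "t \<otimes> h" h] c h by (auto simp: D_def m_comm)
  have T': "factorization G H (insert (t \<otimes> h) D)"
  proof (rule factorizationI)
    fix g assume "g \<in> carrier G"
    then obtain k u where ku: "k \<in> H" "u \<in> T" "g = k \<otimes> u"
      using TD(3) by blast
    show "\<exists>x\<in>H. \<exists>y\<in>insert (t \<otimes> h) D. g = x \<otimes> y"
    proof (cases "u = t")
      case True
      have "k \<in> carrier G"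
        using ku(1) H by (rule subgroup.mem_carrier[rotated])
      then have "g = (k \<otimes> inv h) \<otimes> (t \<otimes> h)"
        using ku True c mult_mult_inv_cancel[of "inv h" t] by (simp add: m_assoc)
      then show ?thesis
        using subgroup.m_closed[OF H ku(1) subgroup.m_inv_closed[OF H h(1)]] by blast
    qed (use ku in \<open>auto simp: D_def\<close>)
  next
    fix x y x' y'
    assume *: "x \<in> H" "y \<in> insert (t \<otimes> h) D" "x' \<in> H" "y' \<in> insert (t \<otimes> h) D"
      "x \<otimes> y = x' \<otimes> y'"
    have xc: "x \<in> carrier G" "x' \<in> carrier G"
      using * H subgroup.mem_carrier by auto
    have mixed: False if "a \<in> H" "a' \<in> H" "d \<in> D" "a \<otimes> d = a' \<otimes> (t \<otimes> h)" for a a' d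
    proof -
      have "a \<otimes> d = (a' \<otimes> h) \<otimes> t"
        using that c H by (simp add: m_ac subgroup.mem_carrier)
      then have "d = t"
        using TD(4)[of a d "a' \<otimes> h" t] that t h H by (auto simp: D_def subgroup.m_closed)
      then show False
        using that by (auto simp: D_def)
    qed
    show "x = x' \<and> y = y'"
    proof (cases "y = t \<otimes> h"; cases "y' = t \<otimes> h")
      assume "y = t \<otimes> h" "y' = t \<otimes> h"
      then show ?thesis using * xc c by auto
    next
      assume "y = t \<otimes> h" "y' \<noteq> t \<otimes> h"
      then show ?thesis using mixed[of x' x y'] * by auto
    next
      assume "y \<noteq> t \<otimes> h" "y' = t \<otimes> h"
      then show ?thesis using mixed[of x x' y] * by auto
    next
      assume "y \<noteq> t \<otimes> h" "y' \<noteq> t \<otimes> h"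
      then show ?thesis using TD(4)[of x y x' y'] * by (auto simp: D_def)
    qed
  qed (use H c in \<open>auto dest: subgroup.subset\<close>)
  have "insert t D = T"
    using t by (auto simp: D_def)
  then show ?thesis
    using insert_aperiodic[OF c(3) c(2) c(1) nD h(2)] T T' by auto
qed

text \<open>
  An aperiodic factorization \<open>A B\<close> of \<open>H\<close> extends to the factorization \<open>A (B T)\<close> of \<open>G\<close>, where \<open>T\<close> is an
  aperiodic transversal of \<open>H\<close>. A period of \<open>A\<close> in \<open>G\<close> already lies in \<open>H\<close>. A period of \<open>B T\<close> permutes
  the pieces \<open>B t\<close>, which lie in different cosets of \<open>H\<close>; since \<open>B\<close> is aperiodic it can only do so by
  translating \<open>T\<close>, which is aperiodic as well.
\<close>

lemma (in comm_group) good_subgroup: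
  assumes fin: "finite (carrier G)" and good: "good G" and H: "subgroup H G"
    and h: "h \<in> H" "h \<otimes> h \<noteq> \<one>"
  shows "good (G\<lparr>carrier := H\<rparr>)"
  unfolding good_def
proof (intro allI impI)
  let ?H = "G\<lparr>carrier := H\<rparr>"
  interpret H: group ?H
    using H by (rule subgroup_imp_group)
  fix A B assume AB: "factorization ?H A B"
  note AB_sub = H.factorization_subset[OF AB, simplified]
  note AB_ne = H.factorization_nonempty[OF AB]
  note AB_ex = H.factorization_ex[OF AB, simplified]
  note AB_unique = H.factorization_unique[OF AB, simplified]
  have HG: "H \<subseteq> carrier G"
    using H by (rule subgroup.subset)
  obtain T where T: "factorization G H T" and Taper: "\<not> periodic G T"
    using ex_aperiodic_transversal[OF H h] by auto
  note T_sub = factorization_subset[OF T]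
  note T_unique = factorization_unique[OF T]
  have finT: "finite T"
    using T_sub fin finite_subset by auto
  define Y where "Y = B <#> T"
  have Y: "y \<in> Y \<longleftrightarrow> (\<exists>b\<in>B. \<exists>t\<in>T. y = b \<otimes> t)" for y
    by (auto simp: Y_def set_mult_def)
  have in_c: "a \<in> carrier G" if "a \<in> A \<or> a \<in> B \<or> a \<in> H \<or> a \<in> T" for a
    using that AB_sub T_sub HG by blast
  have AY: "factorization G A Y"
  proof (rule factorizationI)
    show "A \<subseteq> carrier G" "Y \<subseteq> carrier G"
      using in_c by (auto simp: Y)
  next
    fix g assume "g \<in> carrier G"
    then obtain k t where kt: "k \<in> H" "t \<in> T" "g = k \<otimes> t"
      using factorization_ex[OF T] by blast
    then obtain a b where "a \<in> A" "b \<in> B" "k = a \<otimes> b"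
      using AB_ex by blast
    then show "\<exists>x\<in>A. \<exists>y\<in>Y. g = x \<otimes> y"
      using kt in_c by (intro bexI[of _ a] bexI[of _ "b \<otimes> t"]) (auto simp: Y m_assoc)
  next
    fix a y a' y' assume *: "a \<in> A" "y \<in> Y" "a' \<in> A" "y' \<in> Y" "a \<otimes> y = a' \<otimes> y'"
    then obtain b t b' t' where bt: "b \<in> B" "t \<in> T" "y = b \<otimes> t" "b' \<in> B" "t' \<in> T" "y' = b' \<otimes> t'"
      by (auto simp: Y)
    have "(a \<otimes> b) \<otimes> t = (a' \<otimes> b') \<otimes> t'"
      using * bt in_c by (simp add: m_assoc)
    moreover have "a \<otimes> b \<in> H" "a' \<otimes> b' \<in> H"
      using * bt AB_sub H by (auto intro: subgroup.m_closed)
    ultimately have "a \<otimes> b = a' \<otimes> b' \<and> t = t'"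
      using T_unique bt by blast
    then show "a = a' \<and> y = y'"
      using AB_unique[of a b a' b'] * bt by auto
  qed
  \<comment> \<open>A period \<open>g\<close> of \<open>Y\<close> maps \<open>B t\<close> into the coset of \<open>H\<close> through some \<open>t'\<close>, which meets \<open>Y\<close> in \<open>B t'\<close>;
    so the element \<open>k\<close> of \<open>H\<close> with \<open>t g = k t'\<close> is a period of \<open>B\<close>.\<close>
  have Y_periodic: "periodic ?H B" if perY: "periodic G Y"
  proof (rule ccontr)
    assume B: "\<not> periodic ?H B"
    have B_periods: "k = \<one>" if k: "k \<in> H" "\<And>b. b \<in> B \<Longrightarrow> b \<otimes> k \<in> B" for k
    proof -
      have "finite B"
        by (rule finite_subset[OF subset_trans[OF AB_sub(2) HG] fin])
      then have "k \<in> periods ?H B"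
        by (rule H.mem_periodsI) (use AB_sub(2) k in simp_all)
      then show ?thesis
        using H.aperiodicD[OF B] AB_sub(2) AB_ne(2) by simp
    qed
    obtain g where g: "g \<in> periods G Y" "g \<in> carrier G" "g \<noteq> \<one>"
      using perY by (rule periodicE)
    have "t \<otimes> g \<in> T" if t: "t \<in> T" for t
    proof -
      obtain k t' where kt': "k \<in> H" "t' \<in> T" "t \<otimes> g = k \<otimes> t'"
        using factorization_ex[OF T, of "t \<otimes> g"] t in_c g by auto
      have "b \<otimes> k \<in> B" if b: "b \<in> B" for b
      proof -
        have "b \<otimes> t \<in> Y"
          using b t by (auto simp: Y)
        then have "(b \<otimes> t) \<otimes> g \<in> Y"
          by (rule mem_periodsD[OF g(1)])
        then obtain b' t'' where b': "b' \<in> B" "t'' \<in> T" "(b \<otimes> t) \<otimes> g = b' \<otimes> t''"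
          by (auto simp: Y)
        have "(b \<otimes> k) \<otimes> t' = b' \<otimes> t''"
          using b'(3) kt' b t g in_c by (simp add: m_assoc)
        then show ?thesis
          using T_unique[of "b \<otimes> k" t' b' t''] b b' kt' AB_sub H
          by (auto simp: subgroup.m_closed subset_iff)
      qed
      then show ?thesis
        using B_periods[OF kt'(1)] kt' in_c by auto
    qed
    then have "g \<in> periods G T"
      using finT T_sub g by (intro mem_periodsI) auto
    then show False
      using aperiodicD[OF Taper] T_sub factorization_nonempty[OF T] g by auto
  qed
  have A_periodic: "periodic ?H A" if A: "periodic G A"
  proof -
    obtain g where g: "g \<in> periods G A" "g \<in> carrier G" "g \<noteq> \<one>"
      using A by (rule periodicE)
    obtain a where a: "a \<in> A"
      using AB_ne by auto
    then have ag: "a \<otimes> g \<in> A"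
      by (rule mem_periodsD[OF g(1)])
    have "inv a \<otimes> (a \<otimes> g) \<in> H"
      using a ag AB_sub H by (auto intro: subgroup.m_closed subgroup.m_inv_closed)
    then have "g \<in> H"
      using a g in_c by (simp flip: m_assoc)
    then have "g \<in> periods ?H A"
      using g AB_sub by (simp add: periods_def r_coset_def)
    then show ?thesis
      using g AB_sub AB_ne by (auto simp: periodic_def)
  qed
  show "periodic ?H A \<or> periodic ?H B"
    using good AY A_periodic Y_periodic by (auto simp: good_def)
qed

section \<open>Embedding the quotient by a subgroup of prime order\<close>

text \<open>
  An element whose \<open>q ^ k\<close>-th power is \<open>l\<close> has order \<open>q ^ Suc k\<close>, because \<open>l\<close> has order \<open>q\<close>.
  This bounds \<open>k\<close> by the order of the group, so a largest \<open>k\<close> exists.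
\<close>

lemma (in comm_group) ex_max_power_root:
  assumes fin: "finite (carrier G)" and q: "prime (q::nat)"
    and l: "l \<in> carrier G" "l [^] q = \<one>" "l \<noteq> \<one>"
  obtains x k where "x \<in> carrier G" "x [^] (q ^ k) = l" "ord x = q ^ Suc k"
    and "\<And>y. y \<in> carrier G \<Longrightarrow> y [^] (q ^ Suc k) \<noteq> l"
proof -
  have ord_root: "ord x = q ^ Suc k" if x: "x \<in> carrier G" "x [^] (q ^ k) = l" for x k
  proof -
    have "x [^] (q ^ Suc k) = (x [^] (q ^ k)) [^] q"
      using x(1) by (simp add: nat_pow_pow mult.commute)
    then have "ord x dvd q ^ Suc k"
      using x l(2) pow_eq_id[OF x(1)] by simp
    then obtain i where i: "i \<le> Suc k" "ord x = q ^ i"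
      using q divides_primepow_nat by blast
    have "\<not> i \<le> k"
    proof
      assume "i \<le> k"
      then have "ord x dvd q ^ k"
        by (simp add: i(2) le_imp_power_dvd)
      then have "x [^] (q ^ k) = \<one>"
        using pow_eq_id[OF x(1)] by blast
      then show False
        using x(2) l(3) by simp
    qed
    then show ?thesis
      using i by (simp add: le_Suc_eq)
  qed
  define P where "P k \<longleftrightarrow> (\<exists>x\<in>carrier G. x [^] (q ^ k) = l)" for k
  have "P 0"
    using l(1) by (auto simp: P_def)
  moreover have "k \<le> order G" if Pk: "P k" for k
  proof -
    obtain x where x: "x \<in> carrier G" "x [^] (q ^ k) = l"
      using Pk unfolding P_def by blast
    have "k < q ^ k"
      using power_gt_expt prime_gt_1_nat[OF q] by simp
    also have "\<dots> \<le> q ^ Suc k"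
      using prime_ge_1_nat[OF q] by simp
    also have "\<dots> \<le> order G"
      using ord_root[OF x] ord_le_group_order[OF fin x(1)] by simp
    finally show ?thesis
      by simp
  qed
  ultimately obtain k where k: "P k" "\<And>j. P j \<Longrightarrow> j \<le> k"
    using Nat.ex_has_greatest_nat[of P 0 "order G"] by blast
  obtain x where x: "x \<in> carrier G" "x [^] (q ^ k) = l"
    using k(1) unfolding P_def by blast
  show thesis
  proof (rule that[OF x ord_root[OF x]])
    fix y assume "y \<in> carrier G"
    then show "y [^] (q ^ Suc k) \<noteq> l"
      using k(2)[of "Suc k"] unfolding P_def by auto
  qed
qed

text \<open>
  This is the special case needed here of the fact that a bounded pure subgroup is a direct factor.
  Choose \<open>x\<close> to be a root of \<open>l\<close> of maximal \<open>q\<close>-power degree \<open>q ^ k\<close> and let \<open>X\<close> be the cyclic group it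
  generates. By maximality \<open>l\<close> is not in the subgroup \<open>N\<close> of all \<open>q ^ Suc k\<close>-th powers, so there is a
  largest subgroup \<open>K\<close> that contains \<open>N\<close> and avoids \<open>l\<close>. Avoiding \<open>l\<close> means meeting \<open>X\<close> trivially. If
  \<open>K X\<close> were not everything, some \<open>g\<close> outside it would have its \<open>q\<close>-th power \<open>a y\<close> inside it; as \<open>N\<close> lies in \<open>K\<close>, the
  factor \<open>y\<close> from \<open>X\<close> is itself a \<open>q\<close>-th power in \<open>X\<close> and can be absorbed into \<open>g\<close>. The resulting
  \<open>g'\<close> has its \<open>q\<close>-th power in \<open>K\<close>, and adjoining it to \<open>K\<close> still avoids \<open>l\<close>, against the choice of \<open>K\<close>.
\<close>

lemma (in comm_group) ex_cyclic_direct_factor: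
  assumes fin: "finite (carrier G)" and q: "prime (q::nat)"
    and l: "l \<in> carrier G" "l [^] q = \<one>" "l \<noteq> \<one>"
  obtains K X where "subgroup K G" "subgroup X G" "K \<inter> X = {\<one>}" "K <#> X = carrier G"
    and "l \<in> X" "\<And>y. y \<in> X \<Longrightarrow> y [^] q = \<one> \<Longrightarrow> y \<in> generate G {l}"
proof -
  obtain x k where x: "x \<in> carrier G" "x [^] (q ^ k) = l" "ord x = q ^ Suc k"
    and root: "\<And>y. y \<in> carrier G \<Longrightarrow> y [^] (q ^ Suc k) \<noteq> l"
    using ex_max_power_root[OF fin q l] by blast
  define X where "X = generate G {x}"
  define N where "N = (\<lambda>g. g [^] (q ^ Suc k)) ` carrier G"
  have X: "subgroup X G"
    unfolding X_def using x(1) by (intro generate_is_subgroup) simp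
  have Xpow: "\<exists>i::nat. y = x [^] i" if "y \<in> X" for y
    using mem_cyclicE[OF fin x(1)] that unfolding X_def by metis
  have xX: "x [^] (i::nat) \<in> X" for i
    using pow_mem_subgroup[OF X] unfolding X_def by (simp add: generate.incl)
  have lX: "l \<in> X"
    using xX[of "q ^ k"] x(2) by simp
  have Xl: "y \<in> generate G {l}" if y: "y \<in> X" "y [^] q = \<one>" for y
  proof -
    obtain i :: nat where i: "y = x [^] i"
      using Xpow[OF y(1)] by blast
    have "x [^] (i * q) = \<one>"
      using y(2) x(1) by (simp add: i nat_pow_pow)
    then have "q ^ k * q dvd i * q"
      using pow_eq_id[OF x(1)] x(3) by (simp add: mult.commute)
    then have "q ^ k dvd i"
      using q by (simp add: prime_gt_0_nat)
    then obtain j where "i = q ^ k * j"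
      by blast
    then have "y = (x [^] (q ^ k)) [^] j"
      by (simp only: i nat_pow_pow[OF x(1)])
    then have "y = l [^] j"
      by (simp only: x(2))
    also have "l [^] j \<in> generate G {l}"
      by (rule pow_mem_subgroup[OF generate_is_subgroup]) (use l(1) in \<open>auto intro: generate.incl\<close>)
    finally show ?thesis .
  qed
  \<comment> \<open>Every nontrivial subgroup of the cyclic \<open>q\<close>-group \<open>X\<close> contains \<open>l\<close>: a suitable \<open>q\<close>-power \<open>z\<close>
    of one of its elements has order \<open>q\<close>, and every such element of \<open>X\<close> has \<open>l\<close> among its powers.\<close>
  have inter: "M \<inter> X = {\<one>}" if M: "subgroup M G" "l \<notin> M" for M
  proof -
    have "y = \<one>" if y: "y \<in> M" "y \<in> X" for y
    proof (rule ccontr)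
      assume ne: "y \<noteq> \<one>"
      have yc: "y \<in> carrier G"
        using y(2) X by (rule subgroup.mem_carrier[rotated])
      obtain i :: nat where i: "y = x [^] i"
        using Xpow[OF y(2)] by blast
      have "y [^] (q ^ Suc k) = (x [^] ord x) [^] i"
        unfolding i x(3)[symmetric] using x(1) by (simp add: nat_pow_pow mult.commute del: pow_ord_eq_1)
      also have "\<dots> = \<one>"
        using x(1) by simp
      finally have ex: "\<exists>j. y [^] (q ^ j) = \<one>"
        by (rule exI)
      define j where "j = (LEAST j. y [^] (q ^ j) = \<one>)"
      have j: "y [^] (q ^ j) = \<one>"
        unfolding j_def by (rule LeastI_ex[OF ex])
      have "j \<noteq> 0"
        using j ne yc by (intro notI) simp
      then obtain j' where j': "j = Suc j'"
        using not0_implies_Suc by blast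
      define z where "z = y [^] (q ^ j')"
      have z: "z \<in> M" "z \<in> X" "z \<in> carrier G"
        unfolding z_def using yc y pow_mem_subgroup M(1) X by simp_all
      have "z \<noteq> \<one>"
        using not_less_Least[of j' "\<lambda>j. y [^] (q ^ j) = \<one>"] j' by (simp add: z_def j_def)
      have "z [^] q = \<one>"
        using j yc by (simp add: z_def j' nat_pow_pow mult.commute)
      then have "z \<in> generate G {l}"
        by (rule Xl[OF z(2)])
      then obtain i :: nat where zi: "z = l [^] i"
        by (rule mem_cyclicE[OF fin l(1)])
      have "\<not> q dvd i"
        using \<open>z \<noteq> \<one>\<close> zi l(1,2) by (auto simp flip: nat_pow_pow)
      moreover have "l [^] q \<in> M" "l [^] i \<in> M"
        using M(1) z(1) zi l(2) by (simp_all add: subgroup.one_closed)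
      ultimately have "l \<in> M"
        using mem_subgroup_of_prime_coprime_pows[OF M(1) l(1)] q by blast
      then show False
        using M(2) by contradiction
    qed
    then show ?thesis
      using subgroup.one_closed[OF M(1)] subgroup.one_closed[OF X] by blast
  qed
  define P where "P K \<longleftrightarrow> subgroup K G \<and> N \<subseteq> K \<and> l \<notin> K" for K
  have "P N"
    using subgroup_powers[of "q ^ Suc k"] root unfolding P_def N_def by blast
  moreover have "card K \<le> order G" if "P K" for K
    using card_mono[OF fin subgroup.subset, of K] that unfolding P_def order_def by simp
  then have "\<forall>K. P K \<longrightarrow> card K < Suc (order G)"
    by (simp add: less_Suc_eq_le)
  ultimately obtain K where K: "P K" and K_max: "\<And>M. P M \<Longrightarrow> card M \<le> card K"
    using ex_has_greatest_nat[of P N card "Suc (order G)"] by blast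
  have sK: "subgroup K G" and NK: "N \<subseteq> K" and lK: "l \<notin> K"
    using K by (simp_all add: P_def)
  note KX_inter = inter[OF sK lK]
  define KX where "KX = K <#> X"
  have sKX: "subgroup KX G"
    unfolding KX_def by (rule mult_subgroups[OF sK X])
  have KX_iff: "g \<in> KX \<longleftrightarrow> (\<exists>a\<in>K. \<exists>y\<in>X. g = a \<otimes> y)" for g
    by (auto simp: KX_def set_mult_def)
  have K_KX: "a \<in> KX" if "a \<in> K" for a
    using that subgroup.one_closed[OF X] subgroup.mem_carrier[OF sK that] unfolding KX_iff
    by (metis r_one)
  have X_KX: "a \<in> KX" if "a \<in> X" for a
    using that subgroup.one_closed[OF sK] subgroup.mem_carrier[OF X that] unfolding KX_iff
    by (metis l_one)
  have step: "g \<in> KX" if g: "g \<in> carrier G" "g [^] q \<in> KX" for g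
  proof (rule ccontr)
    assume gn: "g \<notin> KX"
    obtain a y where ay: "a \<in> K" "y \<in> X" "g [^] q = a \<otimes> y"
      using g(2) unfolding KX_iff by blast
    have c: "a \<in> carrier G" "y \<in> carrier G"
      using ay subgroup.mem_carrier[OF sK] subgroup.mem_carrier[OF X] by blast+
    \<comment> \<open>Raising to the power \<open>q ^ k\<close> shows that \<open>y\<close> is a \<open>q\<close>-th power in \<open>X\<close>.\<close>
    have "y [^] (q ^ k) = \<one>"
    proof -
      have "a [^] (q ^ k) \<otimes> y [^] (q ^ k) = (a \<otimes> y) [^] (q ^ k)"
        using c by (simp add: nat_pow_distrib)
      also have "\<dots> = g [^] (q ^ Suc k)"
        using g(1) by (simp add: ay(3)[symmetric] nat_pow_pow)
      finally have eq: "a [^] (q ^ k) \<otimes> y [^] (q ^ k) = g [^] (q ^ Suc k)" .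
      have "g [^] (q ^ Suc k) \<in> K"
        using NK g(1) unfolding N_def by blast
      moreover have aK: "a [^] (q ^ k) \<in> K"
        by (rule pow_mem_subgroup[OF sK ay(1)])
      moreover have "y [^] (q ^ k) = inv (a [^] (q ^ k)) \<otimes> g [^] (q ^ Suc k)"
      proof -
        have "inv (a [^] (q ^ k)) \<otimes> g [^] (q ^ Suc k) =
            inv (a [^] (q ^ k)) \<otimes> (a [^] (q ^ k) \<otimes> y [^] (q ^ k))"
          by (simp only: eq)
        also have "\<dots> = y [^] (q ^ k)"
          using c by (simp add: m_assoc[symmetric])
        finally show ?thesis
          by (rule sym)
      qed
      ultimately have "y [^] (q ^ k) \<in> K"
        using subgroup.m_closed[OF sK subgroup.m_inv_closed[OF sK aK]] by simp
      moreover have "y [^] (q ^ k) \<in> X"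
        by (rule pow_mem_subgroup[OF X ay(2)])
      ultimately show ?thesis
        using KX_inter by blast
    qed
    obtain i :: nat where i: "y = x [^] i"
      using Xpow[OF ay(2)] by blast
    have "x [^] (i * q ^ k) = \<one>"
      using \<open>y [^] (q ^ k) = \<one>\<close> x(1) by (simp add: i nat_pow_pow)
    then have "q * q ^ k dvd i * q ^ k"
      using pow_eq_id[OF x(1)] x(3) by simp
    then have "q dvd i"
      using q by (simp add: prime_gt_0_nat)
    then obtain j where j: "i = j * q"
      by (metis dvdE mult.commute)
    define y' where "y' = x [^] j"
    have y': "y' \<in> X" "y' \<in> carrier G" "y' [^] q = y"
      using xX x(1) by (simp_all add: y'_def i j nat_pow_pow)
    define g' where "g' = g \<otimes> inv y'"
    have g': "g' \<in> carrier G"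
      using g(1) y'(2) by (simp add: g'_def)
    have g'q: "g' [^] q = a"
      using g(1) y'(2,3) c ay(3) by (simp add: g'_def nat_pow_distrib nat_pow_inv m_assoc)
    have g_eq: "g = g' \<otimes> y'"
      using g(1) y'(2) by (simp add: g'_def m_assoc)
    have g'n: "g' \<notin> KX"
      using gn subgroup.m_closed[OF sKX _ X_KX[OF y'(1)]] unfolding g_eq by blast
    define K' where "K' = K <#> generate G {g'}"
    have sK': "subgroup K' G"
      unfolding K'_def using g' by (intro mult_subgroups[OF sK] generate_is_subgroup) simp
    have "l \<notin> K'"
    proof
      assume "l \<in> K'"
      then obtain b h where bh: "b \<in> K" "h \<in> generate G {g'}" "l = b \<otimes> h"
        unfolding K'_def set_mult_def by blast
      obtain i :: nat where h: "h = g' [^] i"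
        using bh(2) by (rule mem_cyclicE[OF fin g'])
      have bc: "b \<in> carrier G"
        by (rule subgroup.mem_carrier[OF sK bh(1)])
      show False
      proof (cases "q dvd i")
        case True
        then obtain j where "i = q * j"
          by blast
        then have "h = a [^] j"
          using g' by (simp add: h g'q[symmetric] nat_pow_pow)
        then have "h \<in> K"
          using pow_mem_subgroup[OF sK ay(1)] by simp
        then show False
          using lK subgroup.m_closed[OF sK bh(1)] unfolding bh(3) by blast
      next
        case False
        have "g' [^] i = inv b \<otimes> l"
          using bh(3) bc g' by (simp add: h m_assoc[symmetric])
        also have "\<dots> \<in> KX"
          by (rule subgroup.m_closed[OF sKX K_KX[OF subgroup.m_inv_closed[OF sK bh(1)]] X_KX[OF lX]])
        finally have "g' \<in> KX"
          using mem_subgroup_of_prime_coprime_pows[OF sKX g' _ _ q False] g'q K_KX[OF ay(1)] by simp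
        then show False
          using g'n by contradiction
      qed
    qed
    moreover have "K \<subseteq> K'"
    proof
      fix b assume b: "b \<in> K"
      then have "b \<otimes> \<one> \<in> K'"
        unfolding K'_def set_mult_def using generate.one by blast
      then show "b \<in> K'"
        using subgroup.mem_carrier[OF sK b] by simp
    qed
    ultimately have "P K'"
      using sK' NK unfolding P_def by blast
    then have "card K' \<le> card K"
      by (rule K_max)
    then have "K = K'"
      using card_seteq[OF finite_subset[OF subgroup.subset[OF sK'] fin] \<open>K \<subseteq> K'\<close>] by simp
    moreover have "\<one> \<otimes> g' \<in> K'"
      unfolding K'_def set_mult_def using subgroup.one_closed[OF sK] generate.incl[of g' "{g'}"] by blast
    ultimately show False
      using g'n K_KX g' by simp
  qed
  \<comment> \<open>A high enough \<open>q\<close>-power of any element lies in \<open>N\<close>, so \<open>step\<close> can be iterated downwards.\<close>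
  have "g \<in> KX" if g: "g \<in> carrier G" for g
  proof -
    have "g [^] (q ^ j) \<in> KX \<Longrightarrow> g \<in> KX" for j
    proof (induction j)
      case 0
      then show ?case using g by simp
    next
      case (Suc j)
      have "(g [^] (q ^ j)) [^] q \<in> KX"
        using Suc.prems g by (simp add: nat_pow_pow mult.commute)
      then have "g [^] (q ^ j) \<in> KX"
        by (rule step[rotated]) (use g in simp)
      then show ?case
        by (rule Suc.IH)
    qed
    moreover have "g [^] (q ^ Suc k) \<in> KX"
      using NK g K_KX unfolding N_def by blast
    ultimately show ?thesis
      by blast
  qed
  then have "K <#> X = carrier G"
    using subgroup.subset[OF sKX] unfolding KX_def by blast
  then show thesis
    using that[OF sK X KX_inter _ lX Xl] by blast
qed

text \<open>
  On the decomposition \<open>K X\<close> with \<open>X\<close> cyclic of \<open>q\<close>-power order and \<open>l \<in> X\<close>, let the endomorphism fix \<open>K\<close> and raise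
  the \<open>X\<close>-component to the \<open>q\<close>-th power. Its image is a copy, inside the group, of the quotient by
  the subgroup generated by \<open>l\<close>.
\<close>

lemma (in comm_group) ex_endomorphism_with_kernel:
  assumes fin: "finite (carrier G)" and q: "prime (q::nat)"
    and l: "l \<in> carrier G" "l [^] q = \<one>" "l \<noteq> \<one>"
  obtains \<phi> where "\<phi> \<in> hom G G" "kernel G G \<phi> = generate G {l}"
proof -
  obtain K X where sK: "subgroup K G" and X: "subgroup X G" and KX: "K \<inter> X = {\<one>}" "K <#> X = carrier G"
    and lX: "l \<in> X" and Xl: "\<And>y. y \<in> X \<Longrightarrow> y [^] q = \<one> \<Longrightarrow> y \<in> generate G {l}"
    using ex_cyclic_direct_factor[OF fin q l] by blast
  have "\<exists>a y. a \<in> K \<and> y \<in> X \<and> g = a \<otimes> y" if "g \<in> carrier G" for g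
    using KX(2) that unfolding set_mult_def by blast
  then obtain a y where ay: "\<And>g. g \<in> carrier G \<Longrightarrow> a g \<in> K \<and> y g \<in> X \<and> g = a g \<otimes> y g"
    by metis
  have Kc: "b \<in> carrier G" if "b \<in> K" for b
    by (rule subgroup.mem_carrier[OF sK that])
  have Xc: "b \<in> carrier G" if "b \<in> X" for b
    by (rule subgroup.mem_carrier[OF X that])
  have unique: "b = b' \<and> z = z'"
    if b: "b \<in> K" "z \<in> X" "b' \<in> K" "z' \<in> X" "b \<otimes> z = b' \<otimes> z'" for b z b' z'
  proof -
    note c = Kc[OF b(1)] Xc[OF b(2)] Kc[OF b(3)] Xc[OF b(4)]
    have "inv b' \<otimes> b = z' \<otimes> inv z"
    proof -
      have "inv b' \<otimes> b = inv b' \<otimes> (b \<otimes> z) \<otimes> inv z"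
        using c by (simp add: m_assoc)
      also have "\<dots> = z' \<otimes> inv z"
        using c by (simp add: b(5) m_assoc[symmetric])
      finally show ?thesis .
    qed
    moreover have "inv b' \<otimes> b \<in> K" "z' \<otimes> inv z \<in> X"
      using b sK X by (simp_all add: subgroup.m_closed subgroup.m_inv_closed)
    ultimately have 1: "inv b' \<otimes> b = \<one>"
      using KX(1) by (metis IntI singletonD)
    have "b = b' \<otimes> (inv b' \<otimes> b)"
      using c by (simp add: m_assoc[symmetric])
    then have "b = b'"
      using c 1 by simp
    then show ?thesis
      using b(5) c by simp
  qed
  define \<phi> where "\<phi> g = a g \<otimes> y g [^] q" for g
  have \<phi>: "\<phi> (b \<otimes> z) = b \<otimes> z [^] q" if b: "b \<in> K" "z \<in> X" for b z
    using unique[of "a (b \<otimes> z)" "y (b \<otimes> z)" b z] ay[of "b \<otimes> z"] b Kc[OF b(1)] Xc[OF b(2)]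
    by (simp add: \<phi>_def)
  have hom: "\<phi> \<in> hom G G"
  proof (rule homI)
    fix g assume "g \<in> carrier G"
    then show "\<phi> g \<in> carrier G"
      using ay[of g] Kc Xc by (simp add: \<phi>_def)
  next
    fix g h assume gh: "g \<in> carrier G" "h \<in> carrier G"
    have c: "a g \<in> carrier G" "a h \<in> carrier G" "y g \<in> carrier G" "y h \<in> carrier G"
      using ay gh Kc Xc by simp_all
    have "g \<otimes> h = (a g \<otimes> y g) \<otimes> (a h \<otimes> y h)"
      using ay gh by simp
    also have "\<dots> = (a g \<otimes> a h) \<otimes> (y g \<otimes> y h)"
      using c by (simp add: m_ac)
    finally have "\<phi> (g \<otimes> h) = \<phi> ((a g \<otimes> a h) \<otimes> (y g \<otimes> y h))"
      by simp
    also have "\<dots> = (a g \<otimes> a h) \<otimes> (y g \<otimes> y h) [^] q"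
      using ay gh by (intro \<phi> subgroup.m_closed[OF sK] subgroup.m_closed[OF X]) simp_all
    also have "\<dots> = \<phi> g \<otimes> \<phi> h"
      using c by (simp add: \<phi>_def nat_pow_distrib m_ac)
    finally show "\<phi> (g \<otimes> h) = \<phi> g \<otimes> \<phi> h" .
  qed
  have "kernel G G \<phi> = generate G {l}"
  proof
    show "kernel G G \<phi> \<subseteq> generate G {l}"
    proof
      fix g assume "g \<in> kernel G G \<phi>"
      then have g: "g \<in> carrier G" "\<phi> g = \<one>"
        by (simp_all add: kernel_def)
      have "a g \<otimes> y g [^] q = \<one> \<otimes> \<one>"
        using g(2) by (simp add: \<phi>_def)
      then have "a g = \<one> \<and> y g [^] q = \<one>"
        using ay[OF g(1)] pow_mem_subgroup[OF X] sK X by (intro unique) (simp_all add: subgroup.one_closed)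
      then show "g \<in> generate G {l}"
        using Xl[of "y g"] ay[OF g(1)] Xc by (metis l_one)
    qed
    interpret \<phi>: group_hom G G \<phi>
      using hom by unfold_locales
    have "\<phi> l = \<one>"
      using \<phi>[OF subgroup.one_closed[OF sK] lX] l(1,2) by simp
    then have "{l} \<subseteq> kernel G G \<phi>"
      using l(1) by (simp add: kernel_def)
    then show "generate G {l} \<subseteq> kernel G G \<phi>"
      by (rule generate_subgroup_incl[OF _ \<phi>.subgroup_kernel])
  qed
  then show thesis
    using that hom by blast
qed

section \<open>Periodic sets of prime cardinality\<close>

text \<open>
  A periodic set is a disjoint union of cosets of its group of periods. When the number of its
  elements is prime there is a single coset, and it contains \<open>\<one>\<close>.
\<close>

lemma (in comm_group) subgroup_of_periodic_prime_card:
  assumes fin: "finite (carrier G)" and A: "periodic G A" "\<one> \<in> A" and p: "prime (card A)"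
  shows "subgroup A G"
proof -
  define L where "L = periods G A"
  have Ac: "A \<subseteq> carrier G"
    using A(1) by (simp add: periodic_def)
  have L: "subgroup L G"
    unfolding L_def by (rule subgroup_periods[OF Ac])
  have mult: "a \<otimes> g \<in> A" if "a \<in> A" "g \<in> L" for a g
    using mem_periodsD that unfolding L_def by blast
  have LA: "L \<subseteq> A"
  proof
    fix g assume g: "g \<in> L"
    then show "g \<in> A"
      using mult[OF A(2) g] subgroup.mem_carrier[OF L g] by simp
  qed
  define \<C> where "\<C> = (\<lambda>a. L #> a) ` A"
  have sub: "\<C> \<subseteq> rcosets L"
    unfolding \<C>_def RCOSETS_def using Ac by blast
  have coset: "L #> a \<subseteq> A" if a: "a \<in> A" for a
  proof
    fix b assume "b \<in> L #> a"
    then obtain g where g: "g \<in> L" "b = g \<otimes> a"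
      unfolding r_coset_def by blast
    have "a \<in> carrier G"
      using a Ac by blast
    then have "b = a \<otimes> g"
      using g subgroup.mem_carrier[OF L g(1)] by (simp add: m_comm)
    then show "b \<in> A"
      using mult[OF a g(1)] by simp
  qed
  have Un: "\<Union>\<C> = A"
  proof
    show "\<Union>\<C> \<subseteq> A"
      using coset unfolding \<C>_def by blast
    show "A \<subseteq> \<Union>\<C>"
      using rcos_self[OF _ L] Ac unfolding \<C>_def by blast
  qed
  have finA: "finite A"
    using Ac fin by (rule finite_subset)
  have "card L * card \<C> = card (\<Union>\<C>)"
  proof (rule card_partition)
    show "finite \<C>"
      using finA by (simp add: \<C>_def)
    show "finite (\<Union>\<C>)"
      using finA Un by simp
  next
    fix c assume "c \<in> \<C>"
    then show "card c = card L"
      using card_rcosets_equal[OF _ subgroup.subset[OF L]] sub by auto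
  next
    fix c d assume "c \<in> \<C>" "d \<in> \<C>" "c \<noteq> d"
    then show "c \<inter> d = {}"
      using rcos_disjoint[OF L] sub unfolding pairwise_def disjnt_def by blast
  qed
  then have "card L dvd card A"
    unfolding Un by (metis dvd_triv_left)
  moreover have "card L \<noteq> 1"
  proof
    assume "card L = 1"
    then obtain u where "L = {u}"
      by (rule card_1_singletonE)
    then have "L = {\<one>}"
      using subgroup.one_closed[OF L] by blast
    then show False
      using A(1) unfolding periodic_def L_def by blast
  qed
  ultimately have "card L = card A"
    using p prime_nat_iff by blast
  then have "L = A"
    using card_subset_eq[OF finA LA] by blast
  then show ?thesis
    using L by simp
qed

lemma (in group) ex_prime_order_elem:
  assumes fin: "finite (carrier G)" and M: "subgroup M G" "M \<noteq> {\<one>}"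
  obtains l q where "prime (q::nat)" "l \<in> M" "l [^] q = \<one>" "l \<noteq> \<one>"
proof -
  obtain g where g: "g \<in> M" "g \<noteq> \<one>"
    using M(2) subgroup.one_closed[OF M(1)] by blast
  have gc: "g \<in> carrier G"
    by (rule subgroup.mem_carrier[OF M(1) g(1)])
  have "ord g \<noteq> 1"
    using ord_eq_1[OF gc] g(2) by simp
  then obtain q where q: "prime q" "q dvd ord g"
    using prime_factor_nat by blast
  then obtain d where d: "ord g = q * d"
    by blast
  have "g [^] d \<noteq> \<one>"
  proof
    assume "g [^] d = \<one>"
    then have "q * d dvd d"
      using pow_eq_id[OF gc, of d] d by simp
    moreover have "0 < d"
      using ord_ge_1[OF fin gc] d by (intro Nat.gr0I) simp
    moreover have "1 < q"
      by (rule prime_gt_1_nat[OF q(1)])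
    ultimately show False
      using dvd_imp_le[of "q * d" d] by simp
  qed
  moreover have "(g [^] d) [^] q = \<one>"
    using pow_ord_eq_1[OF gc] d gc by (simp add: nat_pow_pow mult.commute)
  ultimately show thesis
    using that[OF q(1) pow_mem_subgroup[OF M(1) g(1)]] by blast
qed

text \<open>
  In a subgroup of odd prime order, a nontrivial element that is its own inverse would generate a
  subgroup of order two, which does not divide the odd order.
\<close>

lemma (in group) ex_non_involution:
  assumes fin: "finite (carrier G)" and p: "prime p" "odd p" "p dvd order G"
  shows "\<exists>h\<in>carrier G. h \<otimes> h \<noteq> \<one>"
proof -
  obtain m where "order G = p ^ 1 * m"
    using p(3) by auto
  then obtain P where P: "subgroup P G" "card P = p"
    using sylow_thm[OF p(1) is_group, of 1 m] fin by auto
  interpret P: group "G\<lparr>carrier := P\<rparr>"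
    using P(1) by (rule subgroup_imp_group)
  have "P \<noteq> {\<one>}"
    using P(2) p(1) by auto
  then obtain h where h: "h \<in> P" "h \<noteq> \<one>"
    using subgroup.one_closed[OF P(1)] by blast
  have hc: "h \<in> carrier G"
    by (rule subgroup.mem_carrier[OF P(1) h(1)])
  have "h \<otimes> h \<noteq> \<one>"
  proof
    assume hh: "h \<otimes> h = \<one>"
    have "subgroup {\<one>, h} (G\<lparr>carrier := P\<rparr>)"
    proof (rule P.subgroupI)
      show "{\<one>, h} \<subseteq> carrier (G\<lparr>carrier := P\<rparr>)"
        using h(1) subgroup.one_closed[OF P(1)] by simp
    next
      fix a assume a: "a \<in> {\<one>, h}"
      have "inv h = h"
        by (rule inv_equality[OF hh hc hc])
      then show "inv\<^bsub>G\<lparr>carrier := P\<rparr>\<^esub> a \<in> {\<one>, h}"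
        using a m_inv_consistent[OF P(1), of a] h(1) subgroup.one_closed[OF P(1)] by auto
    next
      fix a b assume "a \<in> {\<one>, h}" "b \<in> {\<one>, h}"
      then show "a \<otimes>\<^bsub>G\<lparr>carrier := P\<rparr>\<^esub> b \<in> {\<one>, h}"
        using hh hc by auto
    qed simp
    then have "card (rcosets\<^bsub>G\<lparr>carrier := P\<rparr>\<^esub> {\<one>, h}) * card {\<one>, h} = card P"
      using P.lagrange by (simp add: order_def)
    moreover have "card {\<one>, h} = 2"
      using h(2) by simp
    ultimately have "even p"
      unfolding P(2)[symmetric] by (metis dvd_triv_right)
    then show False
      using p(2) by contradiction
  qed
  then show ?thesis
    using hc by blast
qed

section \<open>Factorizations under homomorphisms\<close>

lemma (in group_hom) subgroup_preimage:
  assumes "subgroup M H"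
  shows "subgroup {g \<in> carrier G. h g \<in> M} G"
proof (rule G.subgroupI)
  have "\<one> \<in> {g \<in> carrier G. h g \<in> M}"
    using subgroup.one_closed[OF assms] by simp
  then show "{g \<in> carrier G. h g \<in> M} \<noteq> {}"
    by blast
next
  fix a assume "a \<in> {g \<in> carrier G. h g \<in> M}"
  then show "inv a \<in> {g \<in> carrier G. h g \<in> M}"
    using subgroup.m_inv_closed[OF assms] by simp
next
  fix a b assume "a \<in> {g \<in> carrier G. h g \<in> M}" "b \<in> {g \<in> carrier G. h g \<in> M}"
  then show "a \<otimes> b \<in> {g \<in> carrier G. h g \<in> M}"
    using subgroup.m_closed[OF assms] by simp
qed (rule Collect_restrict)

text \<open>
  The four lemmas starting here let a homomorphism \<open>h\<close> act on a factorization whose second factor \<open>C\<close> is a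
  union of cosets of the kernel of \<open>h\<close>, which is what containment of the kernel in the periods of \<open>C\<close>
  means. Such a \<open>C\<close> is the full preimage of its image.
\<close>

lemma (in group_hom) mem_saturated:
  assumes ker: "kernel G H h \<subseteq> periods G C" and "C \<subseteq> carrier G"
    and "x \<in> C" "y \<in> carrier G" "h x = h y"
  shows "y \<in> C"
proof -
  have x: "x \<in> carrier G"
    using assms(2,3) by blast
  have "h (inv x \<otimes> y) = inv\<^bsub>H\<^esub> h y \<otimes>\<^bsub>H\<^esub> h y"
    using x assms(4,5) by simp
  also have "\<dots> = \<one>\<^bsub>H\<^esub>"
    by (rule H.l_inv) (use assms(4) in simp)
  finally have "h (inv x \<otimes> y) = \<one>\<^bsub>H\<^esub>" .
  moreover have "inv x \<otimes> y \<in> carrier G"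
    using x assms(4) by simp
  ultimately have "inv x \<otimes> y \<in> periods G C"
    using ker unfolding kernel_def by blast
  then have "x \<otimes> (inv x \<otimes> y) \<in> C"
    by (rule G.mem_periodsD[OF _ assms(3)])
  then show ?thesis
    using x assms(4) by (simp add: G.m_assoc[symmetric])
qed

text \<open>
  If \<open>a c\<close> and \<open>a' c'\<close> have the same image, they differ by an element of the kernel, and that
  element can be moved into the factor \<open>c\<close>. Uniqueness in \<open>G\<close> then applies.
\<close>

lemma (in group_hom) factorization_image_unique:
  assumes ker: "kernel G H h \<subseteq> periods G C" and AC: "factorization G A C"
    and *: "a \<in> A" "c \<in> C" "a' \<in> A" "c' \<in> C" "h a \<otimes>\<^bsub>H\<^esub> h c = h a' \<otimes>\<^bsub>H\<^esub> h c'"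
  shows "a = a' \<and> h c = h c'"
proof -
  note sub = G.factorization_subset[OF AC]
  have cc: "a \<in> carrier G" "c \<in> carrier G" "a' \<in> carrier G" "c' \<in> carrier G"
    using * sub by (simp_all add: subset_iff)
  have eq: "h c = h (inv a \<otimes> (a' \<otimes> c'))"
  proof -
    have "h c = inv\<^bsub>H\<^esub> h a \<otimes>\<^bsub>H\<^esub> (h a \<otimes>\<^bsub>H\<^esub> h c)"
      using cc by (simp add: H.m_assoc[symmetric])
    also have "\<dots> = h (inv a \<otimes> (a' \<otimes> c'))"
      using cc *(5) by simp
    finally show ?thesis .
  qed
  have d: "inv a \<otimes> (a' \<otimes> c') \<in> C"
    by (rule mem_saturated[OF ker sub(2) *(2) _ eq]) (use cc in simp)
  have "a \<otimes> (inv a \<otimes> (a' \<otimes> c')) = a' \<otimes> c'"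
    using cc by (simp add: G.m_assoc[symmetric])
  then have "a = a' \<and> inv a \<otimes> (a' \<otimes> c') = c'"
    by (rule G.factorization_unique[OF AC *(1) d *(3,4)])
  then have "a = a'" "inv a \<otimes> (a' \<otimes> c') = c'"
    by blast+
  then show ?thesis
    using eq by metis
qed

lemma (in group_hom) factorization_image:
  assumes ker: "kernel G H h \<subseteq> periods G C" and AC: "factorization G A C"
  shows "factorization (H\<lparr>carrier := h ` carrier G\<rparr>) (h ` A) (h ` C)" and "inj_on h A"
proof -
  note sub = G.factorization_subset[OF AC]
  note unique = factorization_image_unique[OF ker AC]
  interpret I: group "H\<lparr>carrier := h ` carrier G\<rparr>"
    by (rule H.subgroup_imp_group[OF subgroup_img_is_subgroup[OF G.subgroup_self]])
  show "factorization (H\<lparr>carrier := h ` carrier G\<rparr>) (h ` A) (h ` C)"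
  proof (rule I.factorizationI)
    show "h ` A \<subseteq> carrier (H\<lparr>carrier := h ` carrier G\<rparr>)"
      "h ` C \<subseteq> carrier (H\<lparr>carrier := h ` carrier G\<rparr>)"
      using sub by auto
  next
    fix g assume "g \<in> carrier (H\<lparr>carrier := h ` carrier G\<rparr>)"
    then obtain g' where "g' \<in> carrier G" "g = h g'"
      by auto
    then obtain a c where ac: "a \<in> A" "c \<in> C" "g = h (a \<otimes> c)"
      using G.factorization_ex[OF AC] by blast
    then have "g = h a \<otimes>\<^bsub>H\<^esub> h c"
      using sub by (simp add: subset_iff)
    then show "\<exists>x\<in>h ` A. \<exists>y\<in>h ` C. g = x \<otimes>\<^bsub>H\<lparr>carrier := h ` carrier G\<rparr>\<^esub> y"
      using ac by auto
  next
    fix x y x' y' assume *: "x \<in> h ` A" "y \<in> h ` C" "x' \<in> h ` A" "y' \<in> h ` C"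
      "x \<otimes>\<^bsub>H\<lparr>carrier := h ` carrier G\<rparr>\<^esub> y = x' \<otimes>\<^bsub>H\<lparr>carrier := h ` carrier G\<rparr>\<^esub> y'"
    then obtain a c a' c' where ac: "a \<in> A" "c \<in> C" "a' \<in> A" "c' \<in> C"
      "x = h a" "y = h c" "x' = h a'" "y' = h c'"
      by blast
    then show "x = x' \<and> y = y'"
      using unique[OF ac(1-4)] *(5) by simp
  qed
  show "inj_on h A"
  proof (rule inj_onI)
    fix a a' assume a: "a \<in> A" "a' \<in> A" "h a = h a'"
    obtain c where c: "c \<in> C"
      using G.factorization_nonempty[OF AC] by blast
    show "a = a'"
      using unique[OF a(1) c a(2) c] a(3) by simp
  qed
qed

lemma (in group_hom) coset_of_image_coset:
  assumes ker: "kernel G H h \<subseteq> periods G C" and C: "C \<subseteq> carrier G"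
    and M: "subgroup M H" and d: "d \<in> carrier H" and image: "h ` C = M #>\<^bsub>H\<^esub> d"
  shows "\<exists>N c. subgroup N G \<and> c \<in> carrier G \<and> C = N #> c"
proof -
  have "d \<in> h ` C"
    unfolding image by (rule H.rcos_self[OF d M])
  then obtain c where c: "c \<in> C" "d = h c"
    by blast
  have cc: "c \<in> carrier G"
    using c(1) C by blast
  define N where "N = {g \<in> carrier G. h g \<in> M}"
  have N: "subgroup N G"
    unfolding N_def by (rule subgroup_preimage[OF M])
  have "C = N #> c"
  proof
    show "C \<subseteq> N #> c"
    proof
      fix x assume x: "x \<in> C"
      then have xc: "x \<in> carrier G"
        using C by blast
      have "h x \<in> M #>\<^bsub>H\<^esub> d"
        using x unfolding image[symmetric] by blast
      then obtain m where m: "m \<in> M" "h x = m \<otimes>\<^bsub>H\<^esub> d"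
        unfolding r_coset_def by blast
      have mc: "m \<in> carrier H"
        by (rule subgroup.mem_carrier[OF M m(1)])
      have "h (x \<otimes> inv c) = m"
        using m(2) mc xc cc d by (simp add: c(2) H.m_assoc)
      then have "x \<otimes> inv c \<in> N"
        using m(1) xc cc by (simp add: N_def)
      moreover have "x = (x \<otimes> inv c) \<otimes> c"
        using xc cc by (simp add: G.m_assoc)
      ultimately show "x \<in> N #> c"
        unfolding r_coset_def by blast
    qed
  next
    show "N #> c \<subseteq> C"
    proof
      fix x assume "x \<in> N #> c"
      then obtain n where n: "n \<in> carrier G" "h n \<in> M" "x = n \<otimes> c"
        unfolding r_coset_def N_def by blast
      then have "h x = h n \<otimes>\<^bsub>H\<^esub> d"
        using cc c(2) by simp
      then have "h x \<in> h ` C"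
        using n(2) unfolding image r_coset_def by blast
      then obtain y where y: "y \<in> C" "h x = h y"
        by (rule imageE)
      show "x \<in> C"
        by (rule mem_saturated[OF ker C y(1) _ y(2)[symmetric]]) (use n cc in simp)
    qed
  qed
  then show ?thesis
    using N cc by blast
qed

lemma (in comm_group) comm_group_subgroup:
  assumes "subgroup H G"
  shows "comm_group (G\<lparr>carrier := H\<rparr>)"
  by (rule group.group_comm_groupI[OF subgroup_imp_group[OF assms]])
    (simp add: m_comm subgroup.mem_carrier[OF assms])

section \<open>Complements of generating factors of prime cardinality\<close>

text \<open>
  Induction on the order of the group. In a good group \<open>A\<close> or \<open>C\<close> is periodic. If \<open>A\<close> is, it is a
  subgroup; being a generating set it is the whole group, so \<open>C\<close> is a single point. Otherwise \<open>C\<close> has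
  a period \<open>l\<close> of prime order. An endomorphism \<open>\<phi>\<close> with kernel generated by \<open>l\<close> turns the
  factorization into one of the smaller group \<open>\<phi> ` carrier G\<close>, again with a generating first factor of
  \<open>p\<close> elements. As a subgroup of \<open>G\<close> whose order is divisible by the odd prime \<open>p\<close>, this
  group is good. By induction \<open>\<phi> ` C\<close> is a coset there, and so is its preimage \<open>C\<close>.
\<close>

lemma prime_card_generating_factor_complement_is_coset:
  fixes G :: "('a, 'b) monoid_scheme"
  assumes "comm_group G" "finite (carrier G)" "good G" and "prime p" "odd p"
    and "factorization G A C" "card A = p" "\<one>\<^bsub>G\<^esub> \<in> A"
    and "\<And>M. subgroup M G \<Longrightarrow> A \<subseteq> M \<Longrightarrow> M = carrier G"
  shows "\<exists>M c. subgroup M G \<and> c \<in> carrier G \<and> C = M #>\<^bsub>G\<^esub> c"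
  using assms
proof (induction "order G" arbitrary: G A C rule: less_induct)
  case (less G A C)
  interpret comm_group G
    by (rule less.prems)
  note fin = less.prems(2) and p = less.prems(4,5) and AC = less.prems(6)
    and cardA = less.prems(7) and oneA = less.prems(8) and gen = less.prems(9)
  note sub = factorization_subset[OF AC]
  show ?case
  proof (cases "periodic G A")
    case True
    have "subgroup A G"
      by (rule subgroup_of_periodic_prime_card[OF fin True oneA]) (simp add: cardA p)
    then have "A = carrier G"
      using gen by blast
    then have "card C = 1"
      using factorization_card[OF AC] fin one_closed by (auto simp: order_def)
    then obtain c where c: "C = {c}"
      by (rule card_1_singletonE)
    then have cc: "c \<in> carrier G"
      using sub(2) by simp
    then have "C = {\<one>\<^bsub>G\<^esub>} #>\<^bsub>G\<^esub> c"
      by (simp add: c r_coset_def)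
    then show ?thesis
      using triv_subgroup cc by blast
  next
    case False
    then have perC: "periodic G C"
      using less.prems(3) AC unfolding good_def by blast
    have sP: "subgroup (periods G C) G"
      by (rule subgroup_periods[OF sub(2)])
    have "periods G C \<noteq> {\<one>\<^bsub>G\<^esub>}"
      using perC by (simp add: periodic_def)
    then obtain l q where q: "prime (q::nat)" and l: "l \<in> periods G C"
      "l [^]\<^bsub>G\<^esub> q = \<one>\<^bsub>G\<^esub>" "l \<noteq> \<one>\<^bsub>G\<^esub>"
      using ex_prime_order_elem[OF fin sP] by blast
    have lc: "l \<in> carrier G"
      by (rule subgroup.mem_carrier[OF sP l(1)])
    obtain \<phi> where \<phi>: "\<phi> \<in> hom G G" and ker: "kernel G G \<phi> = generate G {l}"
      using ex_endomorphism_with_kernel[OF fin q lc l(2,3)] .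
    interpret \<phi>: group_hom G G \<phi>
      using \<phi> by unfold_locales
    have ker_periods: "kernel G G \<phi> \<subseteq> periods G C"
      unfolding ker by (rule generate_subgroup_incl[OF _ sP]) (simp add: l(1))
    define H where "H = \<phi> ` carrier G"
    let ?H = "G\<lparr>carrier := H\<rparr>"
    have sH: "subgroup H G"
      unfolding H_def by (rule \<phi>.subgroup_img_is_subgroup[OF subgroup_self])
    interpret H: comm_group ?H
      by (rule comm_group_subgroup[OF sH])
    have HG: "H \<subseteq> carrier G"
      by (rule subgroup.subset[OF sH])
    have fin_H: "finite (carrier ?H)"
      using fin by (simp add: H_def)
    have fact_H: "factorization ?H (\<phi> ` A) (\<phi> ` C)" and "inj_on \<phi> A"
      unfolding H_def using \<phi>.factorization_image[OF ker_periods AC] by simp_all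
    then have card_A: "card (\<phi> ` A) = p"
      by (simp add: card_image cardA)
    have one_A: "\<one>\<^bsub>?H\<^esub> \<in> \<phi> ` A"
      using imageI[OF oneA, of \<phi>] by simp
    have order_less: "order ?H < order G"
    proof -
      have "\<not> inj_on \<phi> (carrier G)"
      proof
        assume inj: "inj_on \<phi> (carrier G)"
        have "l \<in> kernel G G \<phi>"
          unfolding ker by (rule generate.incl) simp
        then have "\<phi> l = \<phi> \<one>\<^bsub>G\<^esub>"
          by (simp add: kernel_def)
        then show False
          using inj_onD[OF inj, of l "\<one>\<^bsub>G\<^esub>"] lc l(3) by simp
      qed
      then have "card H \<noteq> card (carrier G)"
        unfolding H_def using eq_card_imp_inj_on[OF fin] by blast
      moreover have "card H \<le> card (carrier G)"
        unfolding H_def by (rule card_image_le[OF fin])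
      ultimately show ?thesis
        by (simp add: order_def)
    qed
    have "p dvd order ?H"
      using H.factorization_card[OF fact_H] card_A by (metis dvd_triv_left)
    then obtain h where "h \<in> H" "h \<otimes>\<^bsub>G\<^esub> h \<noteq> \<one>\<^bsub>G\<^esub>"
      using H.ex_non_involution[OF fin_H p] by auto
    then have good_H: "good ?H"
      by (rule good_subgroup[OF fin less.prems(3) sH])
    have gen_H: "M = carrier ?H" if M: "subgroup M ?H" "\<phi> ` A \<subseteq> M" for M
    proof -
      have "subgroup M G"
        by (rule incl_subgroup[OF sH M(1)])
      then have "subgroup {g \<in> carrier G. \<phi> g \<in> M} G"
        by (rule \<phi>.subgroup_preimage)
      moreover have "A \<subseteq> {g \<in> carrier G. \<phi> g \<in> M}"
        using M(2) sub(1) by blast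
      ultimately have "{g \<in> carrier G. \<phi> g \<in> M} = carrier G"
        by (rule gen)
      then have "H \<subseteq> M"
        unfolding H_def by blast
      then show ?thesis
        using subgroup.subset[OF M(1)] by simp
    qed
    have "\<exists>M d. subgroup M ?H \<and> d \<in> carrier ?H \<and> \<phi> ` C = M #>\<^bsub>?H\<^esub> d"
      by (rule less.hyps[OF order_less H.comm_group_axioms fin_H good_H p fact_H card_A one_A gen_H])
    then obtain M d where M: "subgroup M ?H" "d \<in> H" "\<phi> ` C = M #>\<^bsub>?H\<^esub> d"
      by auto
    have "d \<in> carrier G"
      using M(2) HG by blast
    moreover have "\<phi> ` C = M #>\<^bsub>G\<^esub> d"
      using M(3) by (simp add: r_coset_def)
    ultimately show ?thesis
      by (rule \<phi>.coset_of_image_coset[OF ker_periods sub(2) incl_subgroup[OF sH M(1)]])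
  qed
qed

section \<open>Perfect codes in Cayley graphs\<close>

text \<open>
  In a Cayley graph the closed neighbourhoods of the points \<open>c\<close> of \<open>C\<close> are the sets \<open>(insert \<one> S) c\<close>, and
  a perfect code is a set whose closed neighbourhoods partition the vertices.
\<close>

lemma (in group) perfect_code_cayley_graph_iff:
  assumes S: "connection_set G S"
  shows "perfect_code (cayley_graph G S) C \<longleftrightarrow> factorization G (insert \<one> S) C"
proof -
  have Sc: "s \<in> carrier G" if "s \<in> S" for s
    using S that unfolding connection_set_def by blast
  have S1: "\<one> \<notin> S"
    using S unfolding connection_set_def by blast
  have Sinv: "inv s \<in> S" if "s \<in> S" for s
  proof -
    have "inv s \<in> set_inv S"
      using that unfolding SET_INV_def by blast
    then show ?thesis
      using S unfolding connection_set_def by simp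
  qed
  note dom = dominates_cayley_graph
  have "factorization G (insert \<one> S) C" if PC: "perfect_code (cayley_graph G S) C"
  proof -
    have C: "C \<subseteq> carrier G"
      using PC by (simp add: perfect_code_def cayley_graph_def)
    have indep: "y \<otimes> inv x \<notin> S" if "x \<in> C" "y \<in> C" for x y
    proof -
      have "\<not> x \<rightarrow>\<^bsub>cayley_graph G S\<^esub> y"
        using PC that unfolding perfect_code_def by blast
      then show ?thesis
        using that C by (simp add: dom subset_iff)
    qed
    have nbr: "\<exists>!c. c \<in> C \<and> c \<otimes> inv v \<in> S" if v: "v \<in> carrier G" "v \<notin> C" for v
    proof -
      have "\<exists>!c. c \<in> C \<and> v \<rightarrow>\<^bsub>cayley_graph G S\<^esub> c"
        using PC v by (simp add: perfect_code_def cayley_graph_def)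
      moreover have "(c \<in> C \<and> v \<rightarrow>\<^bsub>cayley_graph G S\<^esub> c) \<longleftrightarrow> (c \<in> C \<and> c \<otimes> inv v \<in> S)" for c
        using v(1) C by (auto simp: dom)
      ultimately show ?thesis
        by simp
    qed
    have inv_nbr: "c \<otimes> inv (s \<otimes> c) \<in> S" if "s \<in> S" "c \<in> C" for s c
    proof -
      have "c \<in> carrier G"
        using that(2) C by blast
      then have "c \<otimes> inv (s \<otimes> c) = inv s"
        using Sc[OF that(1)] by (simp add: inv_mult_group m_assoc[symmetric])
      then show ?thesis
        using Sinv[OF that(1)] by simp
    qed
    have not_code: "s \<otimes> c \<notin> C" if "s \<in> S" "c \<in> C" for s c
      using inv_nbr[OF that] indep[of "s \<otimes> c" c] that(2) by blast
    show ?thesis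
    proof (rule factorizationI)
      show "insert \<one> S \<subseteq> carrier G"
        using Sc by auto
      show "C \<subseteq> carrier G"
        by (rule C)
    next
      fix g assume g: "g \<in> carrier G"
      show "\<exists>x\<in>insert \<one> S. \<exists>y\<in>C. g = x \<otimes> y"
      proof (cases "g \<in> C")
        case True
        then show ?thesis
          using g by (intro bexI[of _ \<one>] bexI[of _ g]) simp_all
      next
        case False
        obtain c where c: "c \<in> C" "c \<otimes> inv g \<in> S"
          using nbr[OF g False] by (rule ex1E) blast
        have cc: "c \<in> carrier G"
          using c(1) C by blast
        have "inv (c \<otimes> inv g) \<in> S"
          by (rule Sinv[OF c(2)])
        moreover have "g = inv (c \<otimes> inv g) \<otimes> c"
          using g cc by (simp add: inv_mult_group m_assoc)
        ultimately show ?thesis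
          using c(1) by blast
      qed
    next
      fix x y x' y' assume *: "x \<in> insert \<one> S" "y \<in> C" "x' \<in> insert \<one> S" "y' \<in> C"
        "x \<otimes> y = x' \<otimes> y'"
      have yc: "y \<in> carrier G" "y' \<in> carrier G"
        using *(2,4) C by blast+
      have xc: "x \<in> carrier G" "x' \<in> carrier G"
        using *(1,3) Sc by auto
      show "x = x' \<and> y = y'"
      proof (cases "x \<in> S")
        case True
        have "x' \<in> S"
        proof (rule ccontr)
          assume "x' \<notin> S"
          then have "x \<otimes> y = y'"
            using *(3,5) yc by simp
          then show False
            using not_code[OF True *(2)] *(4) by simp
        qed
        have "y \<otimes> inv (x \<otimes> y) \<in> S"
          by (rule inv_nbr[OF True *(2)])
        moreover have "y' \<otimes> inv (x \<otimes> y) \<in> S"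
          unfolding *(5) by (rule inv_nbr[OF \<open>x' \<in> S\<close> *(4)])
        ultimately have "y = y'"
          using nbr[OF m_closed[OF xc(1) yc(1)] not_code[OF True *(2)]] *(2,4) by blast
        then show ?thesis
          using *(5) xc yc by simp
      next
        case False
        then have x: "x = \<one>"
          using *(1) by simp
        have "x' \<notin> S"
          using not_code[of x' y'] *(2,4,5) x yc by auto
        then have "x' = \<one>"
          using *(3) by simp
        then show ?thesis
          using x *(5) yc by simp
      qed
    qed
  qed
  moreover have "perfect_code (cayley_graph G S) C" if F: "factorization G (insert \<one> S) C"
  proof -
    note C = factorization_subset(2)[OF F]
    note unique = factorization_unique[OF F]
    show ?thesis
      unfolding perfect_code_def
    proof (intro conjI ballI)
      show "C \<subseteq> verts (cayley_graph G S)"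
        using C by (simp add: cayley_graph_def)
    next
      fix x y assume xy: "x \<in> C" "y \<in> C"
      have c: "x \<in> carrier G" "y \<in> carrier G"
        using xy C by blast+
      have "y \<otimes> inv x \<notin> S"
      proof
        assume s: "y \<otimes> inv x \<in> S"
        have "(y \<otimes> inv x) \<otimes> x = \<one> \<otimes> y"
          using c by (simp add: m_assoc)
        then have "y \<otimes> inv x = \<one>"
          using unique[of "y \<otimes> inv x" x \<one> y] s xy by blast
        then show False
          using s S1 by simp
      qed
      then show "\<not> x \<rightarrow>\<^bsub>cayley_graph G S\<^esub> y"
        by (simp add: dom)
    next
      fix v assume "v \<in> verts (cayley_graph G S) - C"
      then have v: "v \<in> carrier G" "v \<notin> C"
        by (simp_all add: cayley_graph_def)
      obtain s c where sc: "s \<in> insert \<one> S" "c \<in> C" "v = s \<otimes> c"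
        using factorization_ex[OF F v(1)] by blast
      have cc: "c \<in> carrier G"
        using sc(2) C by blast
      have s: "s \<in> S"
        using sc v(2) cc by auto
      have "c \<otimes> inv v = inv s"
        using Sc[OF s] cc by (simp add: sc(3) inv_mult_group m_assoc[symmetric])
      then have adj: "v \<rightarrow>\<^bsub>cayley_graph G S\<^esub> c"
        using Sinv[OF s] v(1) cc by (simp add: dom)
      show "\<exists>!c. c \<in> C \<and> v \<rightarrow>\<^bsub>cayley_graph G S\<^esub> c"
      proof (rule ex1I[of _ c])
        show "c \<in> C \<and> v \<rightarrow>\<^bsub>cayley_graph G S\<^esub> c"
          using sc(2) adj by blast
      next
        fix d assume "d \<in> C \<and> v \<rightarrow>\<^bsub>cayley_graph G S\<^esub> d"
        then have d: "d \<in> C" "d \<in> carrier G" "d \<otimes> inv v \<in> S"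
          by (simp_all add: dom)
        have "inv (d \<otimes> inv v) \<otimes> d = s \<otimes> c"
          using d v(1) by (simp add: sc(3)[symmetric] inv_mult_group m_assoc)
        then show "d = c"
          using unique[of "inv (d \<otimes> inv v)" d s c] Sinv[OF d(3)] d(1) sc(1,2) by blast
      qed
    qed
  qed
  ultimately show ?thesis
    by blast
qed

lemma (in group) connected_cayley_graph_generates:
  assumes S: "S \<subseteq> carrier G" and conn: "Digraph_Component.connected (cayley_graph G S)"
    and M: "subgroup M G" "S \<subseteq> M"
  shows "M = carrier G"
proof -
  let ?D = "mk_symmetric (cayley_graph G S)"
  have step: "y \<in> M" if "x \<in> M" "(x, y) \<in> parcs ?D" for x y
  proof -
    have c: "x \<in> carrier G" "y \<in> carrier G" and "y \<otimes> inv x \<in> S \<or> x \<otimes> inv y \<in> S"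
      using that(2) unfolding parcs_mk_symmetric cayley_graph_def by auto
    then consider "y \<otimes> inv x \<in> M" | "x \<otimes> inv y \<in> M"
      using M(2) by blast
    then show ?thesis
    proof cases
      case 1
      have "y = (y \<otimes> inv x) \<otimes> x"
        using c by (simp add: m_assoc)
      then show ?thesis
        using subgroup.m_closed[OF M(1) 1 that(1)] by simp
    next
      case 2
      have "y = inv (x \<otimes> inv y) \<otimes> x"
        using c by (simp add: inv_mult_group m_assoc)
      then show ?thesis
        using subgroup.m_closed[OF M(1) subgroup.m_inv_closed[OF M(1) 2] that(1)] by simp
    qed
  qed
  have "g \<in> M" if g: "g \<in> carrier G" for g
  proof -
    have "\<one> \<rightarrow>\<^sup>*\<^bsub>with_proj ?D\<^esub> g"
      using conn g unfolding connected_def strongly_connected_def by (simp add: cayley_graph_def)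
    then have "(\<one>, g) \<in> (arcs_ends (with_proj ?D))\<^sup>*"
      by (rule reachable_rtranclI)
    then show ?thesis
    proof (induction rule: rtrancl_induct)
      case base
      show ?case
        by (rule subgroup.one_closed[OF M(1)])
    next
      case (step y z)
      then show ?case
        using \<open>\<And>x y. x \<in> M \<Longrightarrow> (x, y) \<in> parcs ?D \<Longrightarrow> y \<in> M\<close> by (simp add: arcs_ends_conv)
    qed
  qed
  then show ?thesis
    using subgroup.subset[OF M(1)] by blast
qed

lemma (in group) factorizationI_card:
  assumes fin: "finite (carrier G)" and sub: "X \<subseteq> carrier G" "Y \<subseteq> carrier G"
    and card: "card X * card Y = order G"
    and unique: "\<And>x y x' y'. x \<in> X \<Longrightarrow> y \<in> Y \<Longrightarrow> x' \<in> X \<Longrightarrow> y' \<in> Y \<Longrightarrow>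
      x \<otimes> y = x' \<otimes> y' \<Longrightarrow> x = x' \<and> y = y'"
  shows "factorization G X Y"
proof (rule factorizationI[OF sub _ unique])
  have inj: "inj_on (\<lambda>(x, y). x \<otimes> y) (X \<times> Y)"
    using unique by (intro inj_onI) auto
  have "(\<lambda>(x, y). x \<otimes> y) ` (X \<times> Y) \<subseteq> carrier G"
    using sub by (auto simp: subset_iff)
  moreover have "card ((\<lambda>(x, y). x \<otimes> y) ` (X \<times> Y)) = card (carrier G)"
    using card by (simp add: card_image[OF inj] card_cartesian_product order_def)
  ultimately have "(\<lambda>(x, y). x \<otimes> y) ` (X \<times> Y) = carrier G"
    by (rule card_subset_eq[OF fin])
  then show "\<exists>x\<in>X. \<exists>y\<in>Y. g = x \<otimes> y" if "g \<in> carrier G" for g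
    using that by (auto simp: set_eq_iff image_iff)
qed

text \<open>
  This is Lagrange's theorem in the quotient \<open>G Mod H\<close>.
\<close>

lemma (in comm_group) pow_index_mem:
  assumes H: "subgroup H G" and x: "x \<in> carrier G"
  shows "x [^] card (rcosets H) \<in> H"
proof -
  interpret normal H G
    by (rule subgroup_imp_normal[OF H])
  interpret Q: group "G Mod H"
    by (rule factorgroup_is_group)
  have "H #> x [^] card (rcosets H) = (H #> x) [^]\<^bsub>G Mod H\<^esub> order (G Mod H)"
    using hom_nat_pow[OF r_coset_hom_Mod x is_group Q.is_group] by (simp add: order_def FactGroup_def)
  also have "\<dots> = H"
  proof -
    have "H #> x \<in> carrier (G Mod H)"
      using rcosetsI[OF subset x] by (simp add: FactGroup_def)
    then show ?thesis
      using Q.pow_order_eq_1 by simp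
  qed
  finally show ?thesis
    by (rule coset_join1) (use x H in simp_all)
qed

text \<open>
  The quotient by \<open>H\<close> is cyclic of odd prime order \<open>p\<close>. For \<open>x\<close> outside \<open>H\<close>, the powers of \<open>x\<close> with exponents
  from \<open>-m\<close> to \<open>m\<close>, where \<open>p = 2 m + 1\<close>, form a transversal of \<open>H\<close> that is closed under
  inverses and contains \<open>\<one>\<close>; the connection set consists of the nontrivial ones.
\<close>

lemma (in comm_group) ex_connection_set_complementing_coset:
  assumes fin: "finite (carrier G)" and p: "prime p" "odd p" "p dvd order G"
    and H: "subgroup H G" "card H = order G div p" and C: "C \<in> rcosets H"
  shows "\<exists>S. connection_set G S \<and> card S = p - 1 \<and> factorization G (insert \<one> S) C"
proof -
  have card_H: "card H > 0" "order G = p * card H"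
  proof -
    show "card H > 0"
      using subgroup.subset[OF H(1)] subgroup.one_closed[OF H(1)] fin
      by (metis card_gt_0_iff empty_iff finite_subset)
    show "order G = p * card H"
      using p(3) H(2) by simp
  qed
  then have "card H * p = card H * card (rcosets H)"
    using lagrange[OF H(1)] by (simp add: mult.commute)
  then have index: "card (rcosets H) = p"
    using card_H(1) by simp
  have "H \<noteq> carrier G"
    using card_H prime_gt_1_nat[OF p(1)] by (auto simp: order_def)
  then obtain x where x: "x \<in> carrier G" "x \<notin> H"
    using subgroup.subset[OF H(1)] by blast
  have xp: "x [^] int p \<in> H"
    using pow_index_mem[OF H(1) x(1)] index by (simp add: int_pow_int)
  define m where "m = int ((p - 1) div 2)"
  have m: "int p = 2 * m + 1" "m \<ge> 0"
    using p(2) prime_gt_0_nat[OF p(1)] by (auto simp: m_def elim!: oddE)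
  \<comment> \<open>Different exponents in the range differ by a number \<open>d\<close> prime to \<open>p\<close>. As \<open>H\<close> contains the
    \<open>p\<close>-th power of \<open>x\<close> but not \<open>x\<close>, it does not contain the \<open>d\<close>-th power either.\<close>
  have exps: "i = j" if ij: "i \<in> {-m..m}" "j \<in> {-m..m}" "x [^] (i - j) \<in> H" for i j
  proof (rule ccontr)
    assume "i \<noteq> j"
    then have "0 < \<bar>i - j\<bar>" "\<bar>i - j\<bar> < int p"
      using ij m by auto
    then have "\<not> int p dvd i - j"
      using zdvd_not_zless[of "\<bar>i - j\<bar>" "int p"] by simp
    then have "coprime (int p) (i - j)"
      using p(1) by (intro prime_imp_coprime) simp_all
    then show False
      using mem_subgroup_of_coprime_pows[OF H(1) x(1) xp ij(3)] x(2) by simp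
  qed
  define A where "A = (\<lambda>i. x [^] i) ` {-m..m}"
  have inj: "inj_on (\<lambda>i. x [^] i) {-m..m}"
  proof (rule inj_onI)
    fix i j assume ij: "i \<in> {-m..m}" "j \<in> {-m..m}" "x [^] i = x [^] j"
    have "x [^] (i - j) = \<one>"
      using x(1) ij(3) by (simp add: int_pow_diff)
    then show "i = j"
      using exps[OF ij(1,2)] subgroup.one_closed[OF H(1)] by simp
  qed
  have card_A: "card A = p"
    unfolding A_def card_image[OF inj] using m by simp
  have Ac: "A \<subseteq> carrier G"
    unfolding A_def using x(1) by auto
  have oneA: "\<one> \<in> A"
    unfolding A_def by (rule image_eqI[of _ _ 0]) (use m in simp_all)
  define S where "S = A - {\<one>}"
  have A_S: "insert \<one> S = A"
    unfolding S_def using oneA by blast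
  have Sinv: "inv s \<in> S" if "s \<in> S" for s
  proof -
    obtain i where i: "i \<in> {-m..m}" "s = x [^] i"
      using \<open>s \<in> S\<close> unfolding S_def A_def by blast
    have "inv s = x [^] (- i)"
      using x(1) i(2) by (simp add: int_pow_neg)
    moreover have "- i \<in> {-m..m}"
      using i(1) by simp
    ultimately have "inv s \<in> A"
      unfolding A_def by blast
    moreover have "inv s \<noteq> \<one>"
      using \<open>s \<in> S\<close> Ac unfolding S_def by (auto simp: subset_iff)
    ultimately show ?thesis
      by (simp add: S_def)
  qed
  have "set_inv S = S"
  proof
    show "set_inv S \<subseteq> S"
      using Sinv unfolding SET_INV_def by blast
    show "S \<subseteq> set_inv S"
    proof
      fix s assume s: "s \<in> S"
      then have "s = inv (inv s)"
        using Ac unfolding S_def by (auto simp: subset_iff)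
      then show "s \<in> set_inv S"
        using Sinv[OF s] unfolding SET_INV_def by blast
    qed
  qed
  then have "connection_set G S"
    using Ac unfolding connection_set_def S_def by blast
  moreover have "card S = p - 1"
    unfolding S_def using oneA card_A by (simp add: card_Diff_singleton)
  moreover have "factorization G A C"
  proof -
    obtain g where g: "g \<in> carrier G" "C = H #> g"
      using C unfolding RCOSETS_def by blast
    have Cc: "C \<subseteq> carrier G"
      unfolding g(2) by (rule r_coset_subset_G[OF subgroup.subset[OF H(1)] g(1)])
    show ?thesis
    proof (rule factorizationI_card[OF fin Ac Cc])
      have "card C = card H"
        using card_rcosets_equal[OF C subgroup.subset[OF H(1)]] by simp
      then show "card A * card C = order G"
        using card_H(2) card_A by simp
    next
      fix a c a' c' assume *: "a \<in> A" "c \<in> C" "a' \<in> A" "c' \<in> C" "a \<otimes> c = a' \<otimes> c'"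
      have cc: "c \<in> carrier G" "c' \<in> carrier G"
        using *(2,4) Cc by blast+
      obtain i j where ij: "i \<in> {-m..m}" "a = x [^] i" "j \<in> {-m..m}" "a' = x [^] j"
        using *(1,3) unfolding A_def by blast
      obtain h h' where h: "h \<in> H" "c = h \<otimes> g" "h' \<in> H" "c' = h' \<otimes> g"
        using *(2,4) unfolding g(2) r_coset_def by blast
      have hc: "h \<in> carrier G" "h' \<in> carrier G"
        using h(1,3) subgroup.mem_carrier[OF H(1)] by blast+
      have xc: "x [^] i \<in> carrier G" "x [^] j \<in> carrier G"
        using x(1) by simp_all
      have "(x [^] i \<otimes> h) \<otimes> g = (x [^] j \<otimes> h') \<otimes> g"
        using *(5) xc hc g(1) by (simp add: h(2,4) ij(2,4) m_assoc)
      then have eq: "x [^] i \<otimes> h = x [^] j \<otimes> h'"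
        using xc hc g(1) by simp
      have "x [^] (i - j) = inv (x [^] j) \<otimes> x [^] i"
        using x(1) xc by (simp add: int_pow_diff m_comm)
      also have "\<dots> = inv (x [^] j) \<otimes> (x [^] i \<otimes> h) \<otimes> inv h"
        using xc hc by (simp add: m_assoc)
      also have "\<dots> = h' \<otimes> inv h"
        unfolding eq using xc hc by (simp add: m_assoc[symmetric])
      also have "\<dots> \<in> H"
        using h(1,3) by (simp add: subgroup.m_closed[OF H(1)] subgroup.m_inv_closed[OF H(1)])
      finally have "i = j"
        by (rule exps[OF ij(1,3)])
      then have "a = a'"
        using ij(2,4) by simp
      then show "a = a' \<and> c = c'"
        using *(5) xc cc ij(2,4) by simp
    qed
  qed
  ultimately show ?thesis
    using A_S by metis
qed

theorem theorem3p1: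
  fixes G :: "('a, 'b) monoid_scheme" and p :: nat
  assumes "comm_group G" and "finite (carrier G)" and "good G"
    and "prime p" and "odd p" and "p dvd order G" and "p < order G"
  shows
    "(\<forall>H. subgroup H G \<and> card H = order G div p \<longrightarrow>
        (\<forall>C \<in> rcosets\<^bsub>G\<^esub> H. \<exists>S. connection_set G S \<and>
           regular_of_degree (cayley_graph G S) (p - 1) \<and>
           perfect_code (cayley_graph G S) C)) \<and>
     (\<forall>S C. connection_set G S \<and>
        regular_of_degree (cayley_graph G S) (p - 1) \<and>
        Digraph_Component.connected (cayley_graph G S) \<and>
        perfect_code (cayley_graph G S) C \<and> card C = order G div p \<longrightarrow>
        (\<exists>H. subgroup H G \<and> card H = order G div p \<and> C \<in> rcosets\<^bsub>G\<^esub> H))"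
proof -
  interpret comm_group G
    by fact
  note regular = regular_cayley_graph_iff[OF is_group]
  show ?thesis
  proof (intro conjI allI impI ballI)
    fix H C assume H: "subgroup H G \<and> card H = order G div p" and C: "C \<in> rcosets\<^bsub>G\<^esub> H"
    obtain S where "connection_set G S" "card S = p - 1" "factorization G (insert \<one>\<^bsub>G\<^esub> S) C"
      using ex_connection_set_complementing_coset[OF assms(2,4-6) _ _ C] H by blast
    then show "\<exists>S. connection_set G S \<and> regular_of_degree (cayley_graph G S) (p - 1) \<and>
        perfect_code (cayley_graph G S) C"
      using regular perfect_code_cayley_graph_iff by blast
  next
    fix S C assume *: "connection_set G S \<and> regular_of_degree (cayley_graph G S) (p - 1) \<and>
      Digraph_Component.connected (cayley_graph G S) \<and>
      perfect_code (cayley_graph G S) C \<and> card C = order G div p"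
    then have S: "connection_set G S"
      by blast
    have Sc: "S \<subseteq> carrier G" "\<one>\<^bsub>G\<^esub> \<notin> S"
      using S unfolding connection_set_def by blast+
    have F: "factorization G (insert \<one>\<^bsub>G\<^esub> S) C"
      using perfect_code_cayley_graph_iff[OF S] * by blast
    have "card S = p - 1"
      using regular[OF S] * by blast
    then have card: "card (insert \<one>\<^bsub>G\<^esub> S) = p"
      using Sc finite_subset[OF Sc(1) assms(2)] prime_gt_0_nat[OF assms(4)] by simp
    have gen: "M = carrier G" if "subgroup M G" "insert \<one>\<^bsub>G\<^esub> S \<subseteq> M" for M
      using connected_cayley_graph_generates[OF Sc(1)] that * by blast
    have "\<exists>M c. subgroup M G \<and> c \<in> carrier G \<and> C = M #>\<^bsub>G\<^esub> c"
      by (rule prime_card_generating_factor_complement_is_coset[OF assms(1-5) F card _ gen]) simp_all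
    then obtain M c where M: "subgroup M G" "c \<in> carrier G" "C = M #>\<^bsub>G\<^esub> c"
      by blast
    have C: "C \<in> rcosets\<^bsub>G\<^esub> M"
      unfolding M(3) by (rule rcosetsI[OF subgroup.subset[OF M(1)] M(2)])
    then have "card M = order G div p"
      using card_rcosets_equal[OF C subgroup.subset[OF M(1)]] * by simp
    then show "\<exists>H. subgroup H G \<and> card H = order G div p \<and> C \<in> rcosets\<^bsub>G\<^esub> H"
      using M(1) C by blast
  qed
qed

end
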